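(* The overpartition function $\overline{p}$ is log-concave for every integer $n\ge 2$; that is, for every integer $n\ge 2$, $$\log \overline{p}(n+1)-2\log\overline{p}(n)+\log\overline{p}(n-1)\le 0 .$$
   Context: A partition of a positive integer $n$ is a non-increasing sequence of positive integers whose sum is $n$. An overpartition of a positive integer $n$ is a partition of $n$ in which, for each number occurring in it, the last occurrence of that number may (or may not) be overlined. $\overline{p}(n)$ denotes the number of overpartitions of $n$; for example $\overline{p}(1)=2$, $\overline{p}(2)=4$, $\overline{p}(3)=8$, $\overline{p}(4)=14$. For a function $f$, put $\mathcal{C}(f(n)) := \log(f(n+1))-2\log(f(n))+\log(f(n-1))$. The function $f$ is called log-concave for a positive integer $n$ if $\mathcal{C}(f(n))\le 0$. *)

theory Defs
  imports Complex_Main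
begin

definition is_partition :: "nat \<Rightarrow> nat list \<Rightarrow> bool" where
  "is_partition n ps \<longleftrightarrow> sorted_wrt (\<ge>) ps \<and> (\<forall>p\<in>set ps. 0 < p) \<and> sum_list ps = n"

text \<open>An entry \<open>(p, b)\<close> is an occurrence of the number \<open>p\<close>, overlined iff \<open>b\<close> holds.\<close>

definition is_overpartition :: "nat \<Rightarrow> (nat \<times> bool) list \<Rightarrow> bool" where
  "is_overpartition n xs \<longleftrightarrow> is_partition n (map fst xs) \<and>
     (\<forall>i<length xs. snd (xs ! i) \<longrightarrow>
        (\<forall>j. i < j \<and> j < length xs \<longrightarrow> fst (xs ! j) \<noteq> fst (xs ! i)))"

definition num_overpartitions :: "nat \<Rightarrow> nat" where
  "num_overpartitions n = card {xs. is_overpartition n xs}"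

text \<open>The set counted above is finite, so that its \<open>card\<close> is the true number of elements.\<close>

lemma finite_overpartitions: "finite {xs. is_overpartition n xs}"
proof (rule finite_subset)
  let ?A = "{..n} \<times> (UNIV :: bool set)"
  show "{xs. is_overpartition n xs} \<subseteq> {xs. set xs \<subseteq> ?A \<and> length xs \<le> n}"
  proof
    fix xs assume "xs \<in> {xs. is_overpartition n xs}"
    then have pos: "\<forall>p\<in>set (map fst xs). 0 < p" and s: "sum_list (map fst xs) = n"
      by (simp_all add: is_overpartition_def is_partition_def)
    have "set xs \<subseteq> ?A"
      using member_le_sum_list[of _ "map fst xs"] s by fastforce
    moreover have "length xs \<le> sum_list (map fst xs)"
      using pos by (induction xs) fastforce+
    ultimately show "xs \<in> {xs. set xs \<subseteq> ?A \<and> length xs \<le> n}"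
      using s by simp
  qed
  show "finite {xs. set xs \<subseteq> ?A \<and> length xs \<le> n}"
    by (rule finite_lists_length_le) simp
qed

text \<open>The subtraction \<open>n - 1\<close> is truncated, which matters only at \<open>n = 0\<close>, outside the
  intended domain of positive \<open>n\<close>.\<close>

definition log_second_difference :: "(nat \<Rightarrow> real) \<Rightarrow> nat \<Rightarrow> real" where
  "log_second_difference f n = ln (f (n + 1)) - 2 * ln (f n) + ln (f (n - 1))"

definition log_concave_at :: "(nat \<Rightarrow> real) \<Rightarrow> nat \<Rightarrow> bool" where
  "log_concave_at f n \<longleftrightarrow> 0 < n \<and> log_second_difference f n \<le> 0"

end

theory Submission
  imports Defs "HOL-Complex_Analysis.Complex_Analysis"
begin

text \<open>Write \<open>p\<close> for \<open>num_overpartitions\<close> and \<open>P\<close> for its generating function, and let \<open>r = exp (- y)\<close>.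
  By the inequality of the means, \<open>p (n - 1) * p (n + 1) \<le> (p n)\<^sup>2\<close> follows from
  \<open>p (n - 1) / r + p (n + 1) * r \<le> 2 * p n\<close> for a single \<open>r\<close>, and this says that the integral of
  \<open>Re (P (r * cis t) * cis (- n * t)) * (1 - cos t)\<close> over \<open>[0, \<pi>]\<close> is nonnegative. The weight
  \<open>1 - cos t\<close> already accounts for the second difference, so a crude saddle point estimate suffices.
  As \<open>log P\<close> has the nonnegative coefficients \<open>\<Sum>l | l dvd j \<and> odd l. 2 / l\<close>, modulus and phase
  of the integrand are controlled by real moments: the integrand is nonnegative as long as the phase
  stays below \<open>\<pi> / 2\<close>, and for \<open>n \<ge> 600\<close> the rest is smaller than the contribution near \<open>0\<close>.
  For \<open>n \<le> 600\<close> the values are computed by Gauss's recurrence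
  \<open>p n = 2 * (p (n - 1) - p (n - 4) + p (n - 9) - \<dots>)\<close>.\<close>

section \<open>Overpartitions with bounded parts\<close>

text \<open>The inequality of the means holds for every r, so one convenient y is enough, and the
  sign of a single integral replaces estimates of three coefficients to a precision finer than their
  second difference. Near 0 the weight is about t^2 / 2, so gains and losses are both measured in
  h^3, where h is the width of the peak of the modulus. In the variable x = t / h the modulus
  behaves like exp (- x^2) and the nonlinear part of the phase like x^3 / a, with a^2 = pi^2 / (4
  y), the leading term of log P at exp (- y); the pi^2 comes from the sum of 1 / l^2 over odd l. The
  obstacle is that the phase bounds reach pi / 2 at a moderate x unless \<open>a\<close> is large,
  and that beyond this point only the decay of the modulus helps. For n \<ge> 600 one has a \<ge>
  317/50, which is large enough for crude constants.\<close>

definition overpartitions_le :: "nat \<Rightarrow> nat \<Rightarrow> (nat \<times> bool) list set" where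
  "overpartitions_le m n = {xs. is_overpartition n xs \<and> (\<forall>x\<in>set xs. fst x \<le> m)}"

lemma finite_overpartitions_le: "finite (overpartitions_le m n)"
  by (rule finite_subset[OF _ finite_overpartitions[of n]]) (auto simp: overpartitions_le_def)

lemma is_overpartition_Nil: "is_overpartition n [] \<longleftrightarrow> n = 0"
  by (auto simp: is_overpartition_def is_partition_def)

text \<open>An entry is constrained only by what follows it, so prepending \<open>x\<close> adds
  conditions at \<open>x\<close> alone. \<open>fst x \<le> n\<close> keeps the truncated
  \<open>n - fst x\<close> an honest difference.\<close>

lemma is_overpartition_Cons:
  "is_overpartition n (x # xs) \<longleftrightarrow>
     0 < fst x \<and> fst x \<le> n \<and> is_overpartition (n - fst x) xs \<and>
     (\<forall>z\<in>set xs. fst z \<le> fst x \<and> (snd x \<longrightarrow> fst z \<noteq> fst x))"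
proof -
  have *: "(\<forall>i<length (x # xs). snd ((x # xs) ! i) \<longrightarrow>
        (\<forall>j. i < j \<and> j < length (x # xs) \<longrightarrow> fst ((x # xs) ! j) \<noteq> fst ((x # xs) ! i)))
     \<longleftrightarrow> (snd x \<longrightarrow> (\<forall>z\<in>set xs. fst z \<noteq> fst x)) \<and>
      (\<forall>i<length xs. snd (xs ! i) \<longrightarrow>
        (\<forall>j. i < j \<and> j < length xs \<longrightarrow> fst (xs ! j) \<noteq> fst (xs ! i)))"
    (is "?L \<longleftrightarrow> ?R")
  proof
    assume L: ?L
    have "fst z \<noteq> fst x" if "snd x" "z \<in> set xs" for z
    proof -
      from that(2) obtain j where "j < length xs" "z = xs ! j" by (auto simp: in_set_conv_nth)
      then show ?thesis using L[rule_format, of 0 "Suc j"] that(1) by simp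
    qed
    moreover have "fst (xs ! j) \<noteq> fst (xs ! i)" if "i < length xs" "snd (xs ! i)" "i < j" "j < length xs" for i j
      using L[rule_format, of "Suc i" "Suc j"] that by simp
    ultimately show ?R by blast
  next
    assume R: ?R
    show ?L
    proof (intro allI impI)
      fix i j
      assume i: "i < length (x # xs)" "snd ((x # xs) ! i)" and j: "i < j \<and> j < length (x # xs)"
      obtain j' where "j = Suc j'" using j by (cases j) auto
      then show "fst ((x # xs) ! j) \<noteq> fst ((x # xs) ! i)"
        using R i j by (cases i) auto
    qed
  qed
  show ?thesis
    unfolding is_overpartition_def * is_partition_def by auto
qed

lemma overpartitions_le_0: "overpartitions_le 0 n = (if n = 0 then {[]} else {})"
proof -
  have "xs = [] \<and> n = 0" if "xs \<in> overpartitions_le 0 n" for xs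
    using that by (cases xs) (auto simp: overpartitions_le_def is_overpartition_Nil is_overpartition_Cons)
  moreover have "[] \<in> overpartitions_le 0 n \<longleftrightarrow> n = 0"
    by (simp add: overpartitions_le_def is_overpartition_Nil)
  ultimately show ?thesis by auto
qed

text \<open>If \<open>Suc m\<close> occurs, it comes first. A plain copy may be followed by further
  copies, so the rest keeps the bound \<open>Suc m\<close>; an overlined copy is the last one, so
  the bound drops to \<open>m\<close>. This asymmetry produces the factor (1 + X^(m+1)) / (1 -
  X^(m+1)).\<close>

lemma overpartitions_le_Suc:
  "overpartitions_le (Suc m) n = overpartitions_le m n \<union>
     (if Suc m \<le> n then (#) (Suc m, False) ` overpartitions_le (Suc m) (n - Suc m) \<union>
                         (#) (Suc m, True) ` overpartitions_le m (n - Suc m) else {})"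
  (is "?L = ?R")
proof (intro set_eqI iffI)
  fix xs assume xs: "xs \<in> ?L"
  show "xs \<in> ?R"
  proof (cases xs)
    case Nil
    then show ?thesis using xs by (auto simp: overpartitions_le_def)
  next
    case (Cons x ys)
    obtain k b where x: "x = (k, b)" by (cases x)
    show ?thesis
    proof (cases "k = Suc m")
      case True
      then show ?thesis using xs Cons x
        by (cases b) (auto simp: overpartitions_le_def is_overpartition_Cons le_Suc_eq)
    next
      case False
      then show ?thesis using xs Cons x
        by (force simp: overpartitions_le_def is_overpartition_Cons)
    qed
  qed
next
  fix xs assume "xs \<in> ?R"
  then show "xs \<in> ?L"
    by (fastforce simp: overpartitions_le_def is_overpartition_Cons split: if_splits)
qed

definition num_overpartitions_le :: "nat \<Rightarrow> nat \<Rightarrow> nat" where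
  "num_overpartitions_le m n = card (overpartitions_le m n)"

lemma num_overpartitions_le_0: "num_overpartitions_le 0 n = (if n = 0 then 1 else 0)"
  by (simp add: num_overpartitions_le_def overpartitions_le_0)

lemma num_overpartitions_le_Suc:
  "num_overpartitions_le (Suc m) n = num_overpartitions_le m n +
     (if Suc m \<le> n then num_overpartitions_le (Suc m) (n - Suc m) +
                       num_overpartitions_le m (n - Suc m) else 0)"
proof (cases "Suc m \<le> n")
  case True
  let ?B = "(#) (Suc m, False) ` overpartitions_le (Suc m) (n - Suc m)"
  let ?C = "(#) (Suc m, True) ` overpartitions_le m (n - Suc m)"
  have "overpartitions_le (Suc m) n = overpartitions_le m n \<union> (?B \<union> ?C)"
    using True by (subst overpartitions_le_Suc) simp
  moreover have "overpartitions_le m n \<inter> (?B \<union> ?C) = {}" "?B \<inter> ?C = {}"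
    by (auto simp: overpartitions_le_def)
  ultimately show ?thesis
    using True by (simp add: num_overpartitions_le_def card_Un_disjoint finite_overpartitions_le
        card_image)
next
  case False
  then show ?thesis by (subst num_overpartitions_le_def, subst overpartitions_le_Suc)
      (simp add: num_overpartitions_le_def)
qed

lemma num_overpartitions_le_eq: "n \<le> m \<Longrightarrow> num_overpartitions_le m n = num_overpartitions n"
proof -
  assume "n \<le> m"
  have "fst x \<le> n" if "is_overpartition n xs" "x \<in> set xs" for xs x
    using that member_le_sum_list[of "fst x" "map fst xs"]
    by (auto simp: is_overpartition_def is_partition_def)
  then have "overpartitions_le m n = {xs. is_overpartition n xs}"
    using \<open>n \<le> m\<close> by (force simp: overpartitions_le_def)
  then show ?thesis by (simp add: num_overpartitions_le_def num_overpartitions_def)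
qed

lemma num_overpartitions_0: "num_overpartitions 0 = 1"
  using num_overpartitions_le_eq[of 0 0] by (simp add: num_overpartitions_le_0)

lemma num_overpartitions_pos: "0 < num_overpartitions n"
proof (cases n)
  case (Suc m)
  have "is_overpartition n [(n, False)]"
    using Suc by (simp add: is_overpartition_Cons is_overpartition_Nil)
  then have "{xs. is_overpartition n xs} \<noteq> {}" by blast
  then show ?thesis
    using finite_overpartitions[of n] by (simp add: num_overpartitions_def card_gt_0_iff)
qed (simp add: num_overpartitions_0)

section \<open>Generating functions\<close>

text \<open>The finite product of (1 + X^k) / (1 - X^k) over k = 1, ..., m. Its coefficients up to
  degree \<open>m\<close> are already final, so finite products suffice to every order.\<close>

definition overpartition_fps :: "nat \<Rightarrow> 'a::field_char_0 fps" where
  "overpartition_fps m = Abs_fps (\<lambda>n. of_nat (num_overpartitions_le m n))"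

lemma overpartition_fps_0: "overpartition_fps 0 = 1"
  by (rule fps_ext) (simp add: overpartition_fps_def num_overpartitions_le_0)

lemma overpartition_fps_Suc:
  "(1 - fps_X ^ Suc m) * overpartition_fps (Suc m) =
     (1 + fps_X ^ Suc m) * (overpartition_fps m :: 'a::field_char_0 fps)"
proof (rule fps_ext)
  fix n
  show "fps_nth ((1 - fps_X ^ Suc m) * overpartition_fps (Suc m)) n =
    fps_nth ((1 + fps_X ^ Suc m) * (overpartition_fps m :: 'a fps)) n"
    using num_overpartitions_le_Suc[of m n]
    by (simp add: overpartition_fps_def distrib_right left_diff_distrib fps_X_power_mult_nth
        del: power_Suc)
qed

lemma overpartition_fps_nth: "n \<le> m \<Longrightarrow> fps_nth (overpartition_fps m) n = of_nat (num_overpartitions n)"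
  by (simp add: overpartition_fps_def num_overpartitions_le_eq)

text \<open>\<open>X d/dX\<close> of \<open>log ((1 + X ^ k) / (1 - X ^ k))\<close>\<close>

definition log_deriv_factor :: "nat \<Rightarrow> 'a::field_char_0 fps" where
  "log_deriv_factor k = Abs_fps (\<lambda>j. if k dvd j \<and> odd (j div k) then of_nat (2 * k) else 0)"

text \<open>k X^k / (1 + X^k) + k X^k / (1 - X^k) has the common denominator 1 - X^(2k), and its
  expansion keeps the odd multiples of k.\<close>

lemma log_deriv_factor:
  assumes "k > 0"
  shows "(1 - fps_X ^ k * fps_X ^ k) * log_deriv_factor k = fps_const (of_nat (2 * k)) * (fps_X ^ k :: 'a::field_char_0 fps)"
proof (rule fps_ext)
  fix j
  have 1: "(k dvd j \<and> odd (j div k)) \<longleftrightarrow> (k dvd (j - 2 * k) \<and> odd ((j - 2 * k) div k))" if "2 * k \<le> j"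
  proof -
    from le_Suc_ex[OF that] obtain i where "j = i + 2 * k" by (auto simp: add.commute)
    then show ?thesis using assms by auto
  qed
  have 2: "(k dvd j \<and> odd (j div k)) \<longleftrightarrow> j = k" if "j < 2 * k"
  proof -
    have "i = 1" if "j = k * i" "odd i" for i
      using that \<open>j < 2 * k\<close> assms by (cases "i = 0") auto
    then show ?thesis using assms by auto
  qed
  show "fps_nth ((1 - fps_X ^ k * fps_X ^ k) * log_deriv_factor k) j =
    fps_nth (fps_const (of_nat (2 * k)) * (fps_X ^ k :: 'a fps)) j"
    using assms 1 2 unfolding power_add[symmetric] mult_2[symmetric]
    by (cases "j < 2 * k")
       (auto simp: log_deriv_factor_def left_diff_distrib fps_X_power_mult_nth)
qed

text \<open>The logarithmic derivative turns the product into a sum. Instead of dividing, the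
  induction step works with everything multiplied by \<open>1 - Q * Q\<close> and cancels this
  factor at the end.\<close>

lemma overpartition_fps_deriv:
  "fps_X * fps_deriv (overpartition_fps m) =
     overpartition_fps m * (\<Sum>k=1..m. log_deriv_factor k :: 'a::field_char_0 fps)"
proof (induction m)
  case 0
  then show ?case by (simp add: overpartition_fps_0)
next
  case (Suc m)
  define A :: "'a fps" where "A = overpartition_fps (Suc m)"
  define B :: "'a fps" where "B = overpartition_fps m"
  define L :: "'a fps" where "L = (\<Sum>k=1..m. log_deriv_factor k)"
  define G :: "'a fps" where "G = log_deriv_factor (Suc m)"
  define Q :: "'a fps" where "Q = fps_X ^ Suc m"
  define c :: "'a fps" where "c = fps_const (of_nat (Suc m))"
  have AB: "(1 - Q) * A = (1 + Q) * B" unfolding A_def B_def Q_def by (rule overpartition_fps_Suc)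
  have dQ: "fps_X * fps_deriv Q = c * Q"
    by (rule fps_ext) (auto simp: Q_def c_def fps_X_power_nth simp del: power_Suc)
  have "fps_deriv ((1 - Q) * A) = fps_deriv ((1 + Q) * B)" using AB by simp
  then have "(1 - Q) * fps_deriv A - fps_deriv Q * A = (1 + Q) * fps_deriv B + fps_deriv Q * B"
    by simp
  then have *: "(1 - Q) * fps_deriv A = fps_deriv Q * A + (1 + Q) * fps_deriv B + fps_deriv Q * B"
    by (simp add: diff_eq_eq ac_simps)
  have "(1 - Q) * (fps_X * fps_deriv A) = fps_X * ((1 - Q) * fps_deriv A)"
    by (rule mult.left_commute)
  also have "\<dots> = (fps_X * fps_deriv Q) * A + (1 + Q) * (fps_X * fps_deriv B) + (fps_X * fps_deriv Q) * B"
    unfolding * by (simp add: algebra_simps)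
  finally have 1: "(1 - Q) * (fps_X * fps_deriv A) = c * Q * A + (1 + Q) * (B * L) + c * Q * B"
    using Suc.IH by (simp add: dQ B_def L_def)
  have G: "(1 - Q * Q) * G = 2 * c * Q"
    using log_deriv_factor[of "Suc m"] by (simp add: Q_def G_def c_def numeral_fps_const mult.assoc del: power_Suc)
  have "(1 - Q * Q) * (fps_X * fps_deriv A) = (1 + Q) * ((1 - Q) * (fps_X * fps_deriv A))"
    by (simp add: algebra_simps)
  also have "\<dots> = c * Q * ((1 + Q) * A) + (1 + Q) * L * ((1 + Q) * B) + c * Q * ((1 + Q) * B)"
    unfolding 1 by (simp add: algebra_simps)
  also have "\<dots> = (2 * c * Q) * A + (1 - Q * Q) * L * A"
    unfolding AB[symmetric] by (simp add: algebra_simps)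
  also have "\<dots> = (1 - Q * Q) * (A * (L + G))"
    unfolding G[symmetric] by (simp add: algebra_simps)
  finally have eq: "(1 - Q * Q) * (fps_X * fps_deriv A) = (1 - Q * Q) * (A * (L + G))" .
  have "fps_nth (1 - Q * Q) 0 \<noteq> 0" by (simp add: Q_def)
  then have "1 - Q * Q \<noteq> 0" by force
  then have "fps_X * fps_deriv A = A * (L + G)" using eq by simp
  then show ?case by (simp add: A_def L_def G_def add.commute)
qed

text \<open>The coefficient of X^j in log P, because log ((1 + X^k) / (1 - X^k)) is the sum of (2 /
  l) X^(k l) over odd l.\<close>

definition divisor_weight :: "nat \<Rightarrow> real" where
  "divisor_weight j = (\<Sum>l | l dvd j \<and> odd l. 2 / real l)"

lemma sum_log_deriv_factor_nth:
  assumes "1 \<le> j" "j \<le> m"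
  shows "fps_nth (\<Sum>k=1..m. log_deriv_factor k) j = of_nat j * divisor_weight j"
proof -
  have "fps_nth (\<Sum>k=1..m. log_deriv_factor k) j = (\<Sum>k=1..m. if k dvd j \<and> odd (j div k) then real (2 * k) else 0)"
    by (simp add: fps_sum_nth log_deriv_factor_def)
  also have "\<dots> = (\<Sum>k | k dvd j \<and> odd (j div k). real (2 * k))"
  proof -
    have "k \<in> {1..m}" if "k dvd j" for k
      using assms that dvd_imp_le[of k j] by (cases k) auto
    then show ?thesis by (intro sum.mono_neutral_cong_right) auto
  qed
  \<comment> \<open>Complementary divisors l = j / k, under which 2 k becomes j * (2 / l).\<close>
  also have "\<dots> = (\<Sum>l | l dvd j \<and> odd l. real j * (2 / real l))"
    by (rule sum.reindex_bij_witness[of _ "\<lambda>l. j div l" "\<lambda>k. j div k"])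
       (use assms in \<open>auto simp: real_of_nat_div elim!: dvdE\<close>)
  finally show ?thesis by (simp add: divisor_weight_def sum_distrib_left)
qed

text \<open>Compares coefficients in X P' = P * X (log P)'. It serves to identify P with the
  exponential of the weight series.\<close>

lemma num_overpartitions_rec:
  "real n * real (num_overpartitions n) =
     (\<Sum>j=1..n. real j * divisor_weight j * real (num_overpartitions (n - j)))"
proof -
  have "real n * real (num_overpartitions n) = fps_nth (fps_X * fps_deriv (overpartition_fps n)) n"
    by (cases n) (simp_all add: overpartition_fps_nth)
  also have "\<dots> = fps_nth ((\<Sum>k=1..n. log_deriv_factor k) * overpartition_fps n) n"
    by (simp add: overpartition_fps_deriv mult.commute)
  also have "\<dots> = (\<Sum>j=0..n. fps_nth (\<Sum>k=1..n. log_deriv_factor k) j * real (num_overpartitions (n - j)))"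
    by (simp add: fps_mult_nth overpartition_fps_nth)
  also have "\<dots> = (\<Sum>j=1..n. fps_nth (\<Sum>k=1..n. log_deriv_factor k) j * real (num_overpartitions (n - j)))"
    by (rule sum.mono_neutral_right) (auto simp: not_less_eq_eq fps_sum_nth log_deriv_factor_def)
  also have "\<dots> = (\<Sum>j=1..n. real j * divisor_weight j * real (num_overpartitions (n - j)))"
    by (rule sum.cong) (simp_all only: sum_log_deriv_factor_nth atLeastAtMost_iff)
  finally show ?thesis .
qed

section \<open>Gauss's recurrence\<close>

lemma overpartition_fps_Suc_alt:
  "overpartition_fps (Suc m) * ((1 - fps_X ^ Suc m) * inverse (1 + fps_X ^ Suc m)) =
     (overpartition_fps m :: 'a::field_char_0 fps)"
proof -
  have "(1 + fps_X ^ Suc m :: 'a fps) * inverse (1 + fps_X ^ Suc m) = 1"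
    by (rule inverse_mult_eq_1') simp
  then show ?thesis
    using overpartition_fps_Suc[of m, where 'a='a]
    by (metis (no_types, lifting) mult.assoc mult.commute mult_1)
qed

text \<open>Shanks's finite form of Gauss's product formula for \<open>1 + 2 \<Sum>k. (- 1) ^ k * X ^ k\<^sup>2\<close>:
  passing from \<open>m\<close> to \<open>m + 1\<close>, the right-hand side changes by a telescoping sum.\<close>

lemma gauss_finite:
  "overpartition_fps m * (1 + 2 * (\<Sum>k=1..m. (-1) ^ k * fps_X ^ (k ^ 2))) =
     (\<Sum>s=0..m. (-1) ^ s * 2 * inverse (1 + fps_X ^ s) * overpartition_fps s *
        (fps_X ^ (s * (m + 1)) :: 'a::field_char_0 fps))"
proof (induction m)
  case 0
  \<comment> \<open>For s = 0 the factor \<open>inverse (1 + fps_X ^ s)\<close> is 1/2 and cancels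
    the 2.\<close>
  have "inverse (2 :: 'a fps) * 2 = 1" by (rule inverse_mult_eq_1) (simp add: fps_numeral_nth_0)
  then show ?case by (simp add: overpartition_fps_0 mult.commute)
next
  case (Suc m)
  define I :: "nat \<Rightarrow> 'a fps" where "I s = inverse (1 + fps_X ^ s)" for s
  define A :: "nat \<Rightarrow> 'a fps" where "A = overpartition_fps"
  define q where "q s = (fps_X :: 'a fps) ^ s" for s
  define n where "n = Suc m"
  have I: "(1 + q s) * I s = 1" for s
    unfolding I_def q_def by (rule inverse_mult_eq_1') (simp add: fps_X_power_nth)
  have AI: "A (Suc k) * (1 - q (Suc k)) * I (Suc k) = A k" for k
    using overpartition_fps_Suc_alt[of k] unfolding A_def q_def I_def by (simp only: mult.assoc)
  have A_Suc: "(1 - q n) * A n = (1 + q n) * A m"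
    unfolding A_def q_def n_def by (rule overpartition_fps_Suc)
  define U where "U s = (-1) ^ s * 2 * I s * A s" for s
  \<comment> \<open>The boundary terms of the telescoping sum. The value 0 at s = 0 matches the
    factor \<open>1 - q s\<close>, which vanishes there.\<close>
  define V where "V s = (if s = 0 then 0 else 2 * (-1) ^ s * A (s - 1) * q (s * n))" for s
  define S where "S m = 1 + 2 * (\<Sum>k=1..m. (-1) ^ k * (fps_X :: 'a fps) ^ (k ^ 2))" for m
  have IH: "A m * S m = (\<Sum>s=0..m. U s * q (s * n))"
    using Suc.IH unfolding A_def S_def U_def q_def I_def n_def by simp
  have S_n: "S n = S m + 2 * (-1) ^ n * q (n * n)"
    by (simp add: S_def n_def q_def algebra_simps power2_eq_square)
  \<comment> \<open>The bracket is (1 - q s) + q n * (1 + q s). The first summand lowers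
    \<open>A s\<close> to \<open>A (s - 1)\<close>, the second cancels the inverse in
    \<open>U s\<close>, and the results are neighbouring values of \<open>V\<close>.\<close>
  have step: "U s * q (s * n) * ((1 + q n) - (1 - q n) * q s) = V s - V (Suc s)" for s
  proof -
    have U1: "U s * (1 + q s) = 2 * (-1) ^ s * A s"
      using I[of s] unfolding U_def by (simp add: ac_simps)
    have U2: "U s * (1 - q s) * q (s * n) = V s"
    proof (cases s)
      case 0
      then show ?thesis by (simp add: V_def q_def)
    next
      case (Suc k)
      have "U s * (1 - q s) = 2 * (-1) ^ s * (A s * (1 - q s) * I s)"
        unfolding U_def by (simp only: ac_simps)
      then show ?thesis using Suc AI[of k] by (simp add: V_def)
    qed
    have "U s * q (s * n) * ((1 + q n) - (1 - q n) * q s)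
        = U s * (1 - q s) * q (s * n) + U s * (1 + q s) * (q (s * n) * q n)"
      by (simp add: algebra_simps)
    also have "q (s * n) * q n = q (Suc s * n)" by (simp add: q_def flip: power_add)
    also have "U s * (1 + q s) * q (Suc s * n) = - V (Suc s)"
      unfolding U1 by (simp add: V_def)
    finally show ?thesis using U2 by simp
  qed
  have "(1 - q n) * (A n * S n) = (1 + q n) * (A m * S m) + 2 * (-1) ^ n * q (n * n) * ((1 - q n) * A n)"
  proof -
    have "(1 - q n) * (A n * S n) = ((1 - q n) * A n) * S m + 2 * (-1) ^ n * q (n * n) * ((1 - q n) * A n)"
      unfolding S_n by (simp add: algebra_simps)
    then show ?thesis unfolding A_Suc by (simp only: mult.assoc)
  qed
  also have "(1 + q n) * (A m * S m) = (\<Sum>s=0..m. V s - V (Suc s)) + (1 - q n) * (\<Sum>s=0..m. U s * q (s * Suc n))"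
    unfolding IH sum_distrib_left sum.distrib[symmetric]
  proof (rule sum.cong)
    fix s
    have "q (s * Suc n) = q s * q (s * n)" by (simp add: q_def power_add)
    then show "(1 + q n) * (U s * q (s * n)) = V s - V (Suc s) + (1 - q n) * (U s * q (s * Suc n))"
      unfolding step[symmetric] by (simp add: algebra_simps)
  qed simp
  also have "(\<Sum>s=0..m. V s - V (Suc s)) = - V n"
    using sum_telescope[of V m] by (simp add: V_def n_def atLeast0AtMost)
  also have "- V n = - (2 * (-1) ^ n * q (n * n) * A m)"
    by (simp add: V_def n_def)
  also have "A m = (1 - q n) * A n * I n"
    using AI[of m] unfolding n_def by (simp only: mult.commute)
  also have "- (2 * (-1) ^ n * q (n * n) * ((1 - q n) * A n * I n)) +
        (1 - q n) * (\<Sum>s=0..m. U s * q (s * Suc n)) + 2 * (-1) ^ n * q (n * n) * ((1 - q n) * A n)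
      = (1 - q n) * ((\<Sum>s=0..m. U s * q (s * Suc n)) + 2 * (-1) ^ n * q (n * n) * A n * (1 - I n))"
    by (simp add: algebra_simps)
  also have "1 - I n = q n * I n"
    using I[of n] by (simp add: algebra_simps)
  also have "2 * (-1) ^ n * q (n * n) * A n * (q n * I n) = U n * q (n * Suc n)"
    by (simp add: U_def q_def power_add ac_simps)
  also have "(\<Sum>s=0..m. U s * q (s * Suc n)) + U n * q (n * Suc n) = (\<Sum>s=0..n. U s * q (s * Suc n))"
    by (simp add: n_def)
  finally have eq: "(1 - q n) * (A n * S n) = (1 - q n) * (\<Sum>s=0..n. U s * q (s * Suc n))" .
  have "fps_nth (1 - q n) 0 \<noteq> 0" by (simp add: q_def n_def)
  then have "1 - q n \<noteq> 0" by force
  then have "A n * S n = (\<Sum>s=0..n. U s * q (s * Suc n))" using eq by simp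
  then show ?case unfolding A_def S_def U_def q_def I_def n_def by simp
qed

lemma num_overpartitions_gauss:
  assumes "n > 0"
  shows "int (num_overpartitions n) = 2 * (\<Sum>k | 1 \<le> k \<and> k\<^sup>2 \<le> n. - ((-1) ^ k) * int (num_overpartitions (n - k\<^sup>2)))"
proof -
  define A :: "real fps" where "A = overpartition_fps n"
  define B :: "real fps" where "B = (\<Sum>k=1..n. (-1) ^ k * fps_X ^ (k ^ 2))"
  have "fps_nth (A * (1 + 2 * B)) n = 0"
  proof -
    \<comment> \<open>For m = n the term s = 0 of \<open>gauss_finite\<close> is the constant 1, and
      all others start beyond degree n.\<close>
    have "fps_nth ((-1) ^ s * 2 * inverse (1 + fps_X ^ s) * overpartition_fps s *
        (fps_X ^ (s * (n + 1)) :: real fps)) n = 0" for s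
    proof (cases s)
      case 0
      then show ?thesis using assms by (simp add: overpartition_fps_0 fps_X_power_mult_right_nth numeral_fps_const fps_const_inverse)
    next
      case (Suc k)
      have "n < s * (n + 1)" using Suc by simp
      then show ?thesis by (simp only: fps_X_power_mult_right_nth if_True)
    qed
    then show ?thesis unfolding A_def B_def gauss_finite fps_sum_nth by (intro sum.neutral ballI)
  qed
  moreover have "A * (1 + 2 * B) = A + 2 * (\<Sum>k=1..n. fps_const ((-1) ^ k) * (fps_X ^ (k ^ 2) * A))"
    by (simp add: B_def algebra_simps sum_distrib_left flip: fps_const_power fps_const_neg)
  ultimately have "real (num_overpartitions n) +
      2 * (\<Sum>k=1..n. (-1) ^ k * (if n < k\<^sup>2 then 0 else real (num_overpartitions (n - k\<^sup>2)))) = 0"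
    by (simp add: fps_sum_nth fps_X_power_mult_nth A_def overpartition_fps_nth numeral_fps_const cong: if_cong)
  also have "(\<Sum>k=1..n. (-1) ^ k * (if n < k\<^sup>2 then 0 else real (num_overpartitions (n - k\<^sup>2))))
     = (\<Sum>k | 1 \<le> k \<and> k\<^sup>2 \<le> n. (-1) ^ k * real (num_overpartitions (n - k\<^sup>2)))"
  proof -
    have "k \<le> n" if "k\<^sup>2 \<le> n" for k
      using that power2_nat_le_imp_le by blast
    then show ?thesis by (intro sum.mono_neutral_cong_right) auto
  qed
  finally have "real_of_int (int (num_overpartitions n)) =
      real_of_int (2 * (\<Sum>k | 1 \<le> k \<and> k\<^sup>2 \<le> n. - ((-1) ^ k) * int (num_overpartitions (n - k\<^sup>2))))"
    by (simp add: sum_negf)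
  then show ?thesis by (simp only: of_int_eq_iff)
qed

section \<open>Verification for small arguments\<close>

text \<open>The lists below hold \<open>num_overpartitions (n - 1), \<dots>, num_overpartitions 0\<close>. Consecutive
  squares differ by odd numbers, so after the entry for \<open>k\<^sup>2\<close> the next one is \<open>2 k\<close> entries ahead;
  \<open>d\<close> counts the pairs of entries that are still to be skipped.\<close>

fun square_sum :: "nat \<Rightarrow> nat \<Rightarrow> int list \<Rightarrow> int" where
  "square_sum 0 k [] = 0"
| "square_sum 0 k (y # ys) = y - square_sum (Suc k) (Suc k) ys"
| "square_sum (Suc d) k (x # y # ys) = square_sum d k ys"
| "square_sum (Suc d) k _ = 0"

lemma square_sum_skip: "square_sum d k xs = square_sum 0 k (drop (2 * d) xs)"
  by (induction d k xs rule: square_sum.induct) auto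

lemma square_sum_eq:
  "square_sum 0 k (drop ((Suc k)\<^sup>2 - 1) xs) =
     (\<Sum>j | k < j \<and> j\<^sup>2 \<le> length xs. (-1) ^ (j - Suc k) * xs ! (j\<^sup>2 - 1))"
proof (induction "Suc (length xs) - k" arbitrary: k rule: less_induct)
  case less
  have sq: "j \<le> j\<^sup>2" for j :: nat by (simp add: power2_eq_square)
  show ?case
  proof (cases "(Suc k)\<^sup>2 \<le> length xs")
    case False
    have "{j. k < j \<and> j\<^sup>2 \<le> length xs} = {}"
    proof -
      have "(Suc k)\<^sup>2 \<le> j\<^sup>2" if "k < j" for j using that by (intro power_mono) auto
      then show ?thesis using False by fastforce
    qed
    moreover have "drop ((Suc k)\<^sup>2 - 1) xs = []" using False by simp
    ultimately show ?thesis by (simp only: sum.empty square_sum.simps)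
  next
    case True
    let ?P = "(Suc k)\<^sup>2 - 1"
    have P: "?P < length xs" "Suc ?P = (Suc k)\<^sup>2" using True by (auto simp: power2_eq_square)
    have eq: "drop ?P xs = xs ! ?P # drop (Suc ?P) xs" using P(1) by (rule Cons_nth_drop_Suc[symmetric])
    have k: "Suc (length xs) - Suc k < Suc (length xs) - k" using True sq[of "Suc k"] by linarith
    have "square_sum 0 k (drop ?P xs) = xs ! ?P - square_sum 0 (Suc k) (drop (2 * Suc k + (Suc k)\<^sup>2) xs)"
      unfolding eq P(2) by (simp add: square_sum_skip[of "Suc k"] del: power_Suc mult_Suc_right)
    \<comment> \<open>Index j^2 - 1 belongs to j^2 because the head of the list is already at
      distance 1.\<close>
    also have "2 * Suc k + (Suc k)\<^sup>2 = (Suc (Suc k))\<^sup>2 - 1" by (simp add: power2_eq_square)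
    also have "square_sum 0 (Suc k) (drop \<dots> xs) =
        (\<Sum>j | Suc k < j \<and> j\<^sup>2 \<le> length xs. (-1) ^ (j - Suc (Suc k)) * xs ! (j\<^sup>2 - 1))"
      using less[OF k] .
    also have "xs ! ?P - \<dots> = xs ! ?P + (\<Sum>j | Suc k < j \<and> j\<^sup>2 \<le> length xs. (-1) ^ (j - Suc k) * xs ! (j\<^sup>2 - 1))"
    proof -
      have "- ((-1) ^ (j - Suc (Suc k)) * x) = (-1) ^ (j - Suc k) * x" if "Suc k < j" for j and x :: int
      proof -
        have "j - Suc k = Suc (j - Suc (Suc k))" using that by simp
        then show ?thesis by simp
      qed
      then show ?thesis
        unfolding diff_conv_add_uminus sum_negf[symmetric] by (intro arg_cong2[of _ _ _ _ "(+)"] sum.cong) auto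
    qed
    also have "\<dots> = (\<Sum>j\<in>insert (Suc k) {j. Suc k < j \<and> j\<^sup>2 \<le> length xs}. (-1) ^ (j - Suc k) * xs ! (j\<^sup>2 - 1))"
    proof -
      have "{j. Suc k < j \<and> j\<^sup>2 \<le> length xs} \<subseteq> {..length xs}" using sq le_trans by blast
      then show ?thesis by (subst sum.insert) (auto intro: finite_subset)
    qed
    also have "insert (Suc k) {j. Suc k < j \<and> j\<^sup>2 \<le> length xs} = {j. k < j \<and> j\<^sup>2 \<le> length xs}"
      using True by (auto simp: less_Suc_eq_le)
    finally show ?thesis .
  qed
qed

definition overpartition_table :: "nat \<Rightarrow> int list" where
  "overpartition_table n = map (\<lambda>i. int (num_overpartitions i)) (rev [0..<n])"

lemma overpartition_table_Suc:
  "overpartition_table (Suc n) = int (num_overpartitions n) # overpartition_table n"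
  by (simp add: overpartition_table_def)

lemma square_sum_table:
  assumes "n > 0"
  shows "2 * square_sum 0 0 (overpartition_table n) = int (num_overpartitions n)"
proof -
  have "overpartition_table n ! (j\<^sup>2 - 1) = int (num_overpartitions (n - j\<^sup>2))" if "0 < j" "j\<^sup>2 \<le> n" for j
  proof -
    have "0 < j\<^sup>2" using that by simp
    then have "j\<^sup>2 - 1 < n" "n - Suc (j\<^sup>2 - 1) = n - j\<^sup>2" using that by linarith+
    then show ?thesis by (simp add: overpartition_table_def rev_nth)
  qed
  moreover have "(-1) ^ (j - Suc 0) = - ((-1) ^ j :: int)" if "0 < j" for j
    using that by (cases j) auto
  moreover have "length (overpartition_table n) = n" by (simp add: overpartition_table_def)
  ultimately show ?thesis
    unfolding num_overpartitions_gauss[OF assms]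
    using square_sum_eq[of 0 "overpartition_table n"] by (auto simp: Suc_le_eq intro!: sum.cong)
qed

section \<open>Checking the inequality along a growing table of values\<close>

fun check_log_concave :: "nat \<Rightarrow> int list \<Rightarrow> bool" where
  "check_log_concave 0 xs \<longleftrightarrow> True"
| "check_log_concave (Suc m) xs \<longleftrightarrow> (let p = 2 * square_sum 0 0 xs in
     p * xs ! 1 \<le> xs ! 0 * xs ! 0 \<and> check_log_concave m (p # xs))"

lemma check_log_concave:
  "check_log_concave m (overpartition_table (Suc (Suc n))) \<Longrightarrow> i < m \<Longrightarrow>
     num_overpartitions (Suc (Suc (n + i))) * num_overpartitions (n + i) \<le> (num_overpartitions (Suc (n + i)))\<^sup>2"
proof (induction m arbitrary: n i)
  case (Suc m)
  have eq: "2 * square_sum 0 0 (overpartition_table (Suc (Suc n))) = int (num_overpartitions (Suc (Suc n)))"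
    by (rule square_sum_table) simp
  have 0: "int (num_overpartitions (Suc (Suc n))) * int (num_overpartitions n) \<le> int (num_overpartitions (Suc n)) * int (num_overpartitions (Suc n))"
    and rest: "check_log_concave m (overpartition_table (Suc (Suc (Suc n))))"
    using Suc.prems(1) unfolding check_log_concave.simps Let_def eq
    by (simp_all add: overpartition_table_Suc)
  show ?case
  proof (cases i)
    case 0
    then show ?thesis using \<open>int _ * _ \<le> _\<close>
      by (simp add: power2_eq_square flip: of_nat_mult)
  next
    case (Suc i')
    then show ?thesis using Suc.IH[OF rest, of i'] Suc.prems(2) by simp
  qed
qed simp

text \<open>The weak congruence rules below keep the simplifier from traversing the list of values
  again after every step.\<close>

definition check_step :: "bool \<Rightarrow> nat \<Rightarrow> int \<Rightarrow> int list \<Rightarrow> bool" where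
  "check_step c m p xs \<longleftrightarrow> c \<and> check_log_concave m (p # xs)"

definition check_value :: "nat \<Rightarrow> int \<Rightarrow> int list \<Rightarrow> bool" where
  "check_value m p xs \<longleftrightarrow> check_step (p * xs ! 1 \<le> xs ! 0 * xs ! 0) m p xs"

lemma check_log_concave_numeral:
  "check_log_concave (numeral w) xs \<longleftrightarrow> check_value (pred_numeral w) (2 * square_sum 0 0 xs) xs"
  by (simp add: numeral_eq_Suc check_step_def check_value_def Let_def)

lemma check_value_Cons: "check_value m p (a # b # xs) \<longleftrightarrow> check_step (p * b \<le> a * a) m p (a # b # xs)"
  by (simp add: check_value_def)

lemma check_step_True: "check_step True m p xs \<longleftrightarrow> check_log_concave m (p # xs)"
  by (simp add: check_step_def)

lemma check_cong:
  "square_sum d k xs = square_sum d k xs"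
  "check_log_concave m xs = check_log_concave m xs"
  "p = p' \<Longrightarrow> m = m' \<Longrightarrow> check_value m p xs = check_value m' p' xs"
  "c = c' \<Longrightarrow> check_step c m p xs = check_step c' m p xs"
  by simp_all

lemma check_log_concave_600: "check_log_concave 600 [2, 1]"
  by (simp only: check_log_concave_numeral check_log_concave.simps(1) check_value_Cons check_step_True
      square_sum.simps pred_numeral_simps BitM.simps arith_simps mult_1_right mult_zero_right
      mult_zero_left diff_0_right diff_0 minus_zero minus_minus diff_numeral_special
      sub_num_simps dbl_simps dbl_inc_simps dbl_dec_simps one_plus_numeral numeral_plus_one
      one_add_one add_neg_numeral_special le_numeral_simps le_num_simps less_num_simps
      numeral_le_one_iff cong: check_cong)

lemma log_concave_small:
  assumes "1 \<le> n" "n \<le> 600"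
  shows "num_overpartitions (n + 1) * num_overpartitions (n - 1) \<le> (num_overpartitions n)\<^sup>2"
proof -
  have "int (num_overpartitions 1) = 2"
    using square_sum_table[of 1] by (simp add: overpartition_table_def num_overpartitions_0)
  then have "overpartition_table 2 = [2, 1]"
    by (simp add: numeral_2_eq_2 overpartition_table_Suc num_overpartitions_0)
       (simp add: overpartition_table_def)
  then show ?thesis
    \<comment> \<open>The table starts with the values at 1 and 0, so round i = n - 1 tests n, and
      600 rounds cover 1 \<le> n \<le> 600.\<close>
    using check_log_concave[of 600 0 "n - 1"] check_log_concave_600 assms
    by (simp add: numeral_2_eq_2)
qed

section \<open>Moments of the divisor weights\<close>

text \<open>Shifting k and expanding (k + 1)^i expresses the sums with \<open>N + 1\<close> terms
  through those with \<open>N\<close> terms by a monotone map. The closed forms are its fixed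
  points, so induction keeps the partial sums below them.\<close>

lemma sum_powers_geometric_le:
  fixes q :: real
  assumes "0 < q" "q < 1"
  shows "(\<Sum>k<N. q ^ k) \<le> 1 / (1 - q)"
    and "(\<Sum>k<N. real k * q ^ k) \<le> q / (1 - q)\<^sup>2"
    and "(\<Sum>k<N. real k ^ 2 * q ^ k) \<le> q * (1 + q) / (1 - q) ^ 3"
    and "(\<Sum>k<N. real k ^ 3 * q ^ k) \<le> q * (1 + 4 * q + q\<^sup>2) / (1 - q) ^ 4"
proof -
  let ?F0 = "1 / (1 - q)" and ?F1 = "q / (1 - q)\<^sup>2" and ?F2 = "q * (1 + q) / (1 - q) ^ 3"
  let ?F3 = "q * (1 + 4 * q + q\<^sup>2) / (1 - q) ^ 4"
  have nz: "1 - q \<noteq> 0" using assms by simp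
  have F0: "?F0 = 1 + q * ?F0" and F1: "?F1 = q * (?F1 + ?F0)"
    and F2: "?F2 = q * (?F2 + 2 * ?F1 + ?F0)" and F3: "?F3 = q * (?F3 + 3 * ?F2 + 3 * ?F1 + ?F0)"
    using nz by (simp_all add: divide_simps) (simp_all add: eval_nat_numeral algebra_simps)
  have "(\<Sum>k<N. q ^ k) \<le> ?F0 \<and> (\<Sum>k<N. real k * q ^ k) \<le> ?F1 \<and>
      (\<Sum>k<N. real k ^ 2 * q ^ k) \<le> ?F2 \<and> (\<Sum>k<N. real k ^ 3 * q ^ k) \<le> ?F3"
  proof (induction N)
    case 0
    then show ?case using assms by simp
  next
    case (Suc N)
    let ?S0 = "\<Sum>k<N. q ^ k" and ?S1 = "\<Sum>k<N. real k * q ^ k"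
    let ?S2 = "\<Sum>k<N. real k ^ 2 * q ^ k" and ?S3 = "\<Sum>k<N. real k ^ 3 * q ^ k"
    have "(\<Sum>k<Suc N. q ^ k) = 1 + q * ?S0"
      by (simp add: sum.lessThan_Suc_shift sum_distrib_left del: sum.lessThan_Suc)
    moreover have "(\<Sum>k<Suc N. real k * q ^ k) = q * (?S1 + ?S0)"
      by (simp add: sum.lessThan_Suc_shift sum_distrib_left sum.distrib[symmetric] algebra_simps del: sum.lessThan_Suc)
    moreover have "(\<Sum>k<Suc N. real k ^ 2 * q ^ k) = q * (?S2 + 2 * ?S1 + ?S0)"
      by (simp add: sum.lessThan_Suc_shift sum_distrib_left sum.distrib[symmetric] algebra_simps eval_nat_numeral del: sum.lessThan_Suc)
    moreover have "(\<Sum>k<Suc N. real k ^ 3 * q ^ k) = q * (?S3 + 3 * ?S2 + 3 * ?S1 + ?S0)"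
      by (simp add: sum.lessThan_Suc_shift sum_distrib_left sum.distrib[symmetric] algebra_simps eval_nat_numeral del: sum.lessThan_Suc)
    moreover have "q * ?S0 \<le> q * ?F0" "q * (?S1 + ?S0) \<le> q * (?F1 + ?F0)"
      "q * (?S2 + 2 * ?S1 + ?S0) \<le> q * (?F2 + 2 * ?F1 + ?F0)"
      "q * (?S3 + 3 * ?S2 + 3 * ?S1 + ?S0) \<le> q * (?F3 + 3 * ?F2 + 3 * ?F1 + ?F0)"
      using assms Suc by (intro mult_left_mono; linarith)+
    ultimately show ?case using F0 F1 F2 F3 by linarith
  qed
  then show "(\<Sum>k<N. q ^ k) \<le> ?F0" "(\<Sum>k<N. real k * q ^ k) \<le> ?F1"
    "(\<Sum>k<N. real k ^ 2 * q ^ k) \<le> ?F2" "(\<Sum>k<N. real k ^ 3 * q ^ k) \<le> ?F3" by blast+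
qed

text \<open>In the series of 2 cosh x the odd terms cancel and the even ones are nonnegative, so it
  may be cut off anywhere. The term of degree 6 serves the third power sum below.\<close>

lemma exp_add_exp_minus_ge:
  fixes x :: real
  shows "2 + x\<^sup>2 + x ^ 4 / 12 + x ^ 6 / 360 \<le> exp x + exp (- x)"
proof -
  have "(\<lambda>n. x ^ n /\<^sub>R fact n + (- x) ^ n /\<^sub>R fact n) sums (exp x + exp (- x))"
    by (intro sums_add exp_converges)
  moreover have "0 \<le> x ^ n /\<^sub>R fact n + (- x) ^ n /\<^sub>R fact n" for n
    by (cases "even n") auto
  ultimately have "(\<Sum>n<7. x ^ n /\<^sub>R fact n + (- x) ^ n /\<^sub>R fact n) \<le> exp x + exp (- x)"
    by (metis (no_types, lifting) sum_le_suminf sums_iff finite_lessThan)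
  then show ?thesis
    by (simp add: eval_nat_numeral field_simps)
qed

text \<open>As x tends to 0 the full sums behave like i! / x^(i + 1). For i = 1, 2 this is an upper
  bound; for i = 3 the sum exceeds 6 / x^4 by about 1/120 when x is small, hence 63/10. The closed
  forms are expressed through d = 4 sinh^2 (x / 2), and \<open>D\<close> compares d with
  x^2.\<close>

lemma sum_powers_exp_le:
  fixes x :: real
  assumes "x > 0"
  shows "(\<Sum>k<N. real k ^ 1 * exp (- (real k * x))) \<le> 1 / x ^ (1 + 1)"
    and "(\<Sum>k<N. real k ^ 2 * exp (- (real k * x))) \<le> 2 / x ^ (2 + 1)"
    and "(\<Sum>k<N. real k ^ 3 * exp (- (real k * x))) \<le> 63 / 10 / x ^ (3 + 1)"
proof -
  define q where "q = exp (- x)"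
  have q: "0 < q" "q < 1" using assms by (auto simp: q_def)
  have pow: "exp (- (real k * x)) = q ^ k" for k
    by (simp add: q_def exp_of_nat_mult[symmetric])
  define d where "d = (1 - q)\<^sup>2 / q"
  define z where "z = x\<^sup>2"
  have z: "z > 0" using assms by (simp add: z_def)
  have "d = exp x + exp (- x) - 2"
    using q by (simp add: d_def q_def exp_minus field_simps power2_eq_square)
  then have d: "z * (1 + z / 12 + z\<^sup>2 / 360) \<le> d"
    using exp_add_exp_minus_ge[of x] by (simp add: z_def algebra_simps eval_nat_numeral)
  define D where "D = d / z"
  have D: "1 + z / 12 + z\<^sup>2 / 360 \<le> D" using d z by (simp add: D_def field_simps)
  have dz: "d = z * D" using z by (simp add: D_def)
  have D1: "1 + z / 12 \<le> D" using D zero_le_power2[of z] by linarith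
  have D0: "1 \<le> D" "0 < D" using D1 z by linarith+
  have d0: "d > 0" using dz z D0 by simp
  have "q / (1 - q)\<^sup>2 = 1 / d" using q by (simp add: d_def)
  also have "\<dots> \<le> 1 / z" unfolding dz using z D0 by (simp add: field_simps)
  finally show "(\<Sum>k<N. real k ^ 1 * exp (- (real k * x))) \<le> 1 / x ^ (1 + 1)"
    unfolding pow using sum_powers_geometric_le(2)[OF q, of N] by (simp add: z_def power2_eq_square)
  show "(\<Sum>k<N. real k ^ 2 * exp (- (real k * x))) \<le> 2 / x ^ (2 + 1)"
  proof -
    \<comment> \<open>Squaring makes this a rational function of \<open>d\<close>, since (1 + q)^2 =
      q (d + 4).\<close>
    have "(q * (1 + q) / (1 - q) ^ 3)\<^sup>2 = (d + 4) / d ^ 3"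
    proof -
      have "d + 4 = (1 + q)\<^sup>2 / q" using q by (simp add: d_def field_simps power2_eq_square)
      then show ?thesis using q unfolding d_def by (simp add: field_simps power_divide) (simp add: eval_nat_numeral algebra_simps)
    qed
    also have "\<dots> \<le> 4 / z ^ 3"
    proof -
      have "z * D + 4 \<le> 4 * D ^ 3"
      proof -
        have "z * D \<le> 12 * (D - 1) * D" using D1 D0 by (intro mult_right_mono) auto
        moreover have "4 * D ^ 3 - 4 - 12 * (D - 1) * D = 4 * (D - 1) ^ 3"
          by (simp add: eval_nat_numeral algebra_simps)
        moreover have "0 \<le> 4 * (D - 1) ^ 3" using D0 by simp
        ultimately show ?thesis by linarith
      qed
      then have "(z * D + 4) / D ^ 3 / z ^ 3 \<le> 4 / z ^ 3"
        using z D0 by (intro divide_right_mono) (simp_all add: pos_divide_le_eq)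
      then show ?thesis unfolding dz by (simp add: power_mult_distrib mult.commute)
    qed
    also have "\<dots> = (2 / x ^ 3)\<^sup>2" by (simp add: z_def power_divide flip: power_mult)
    finally have "q * (1 + q) / (1 - q) ^ 3 \<le> 2 / x ^ 3"
      by (rule power2_le_imp_le) (use assms in simp)
    then show ?thesis unfolding pow using sum_powers_geometric_le(3)[OF q, of N] by simp
  qed
  show "(\<Sum>k<N. real k ^ 3 * exp (- (real k * x))) \<le> 63 / 10 / x ^ (3 + 1)"
  proof -
    have "q * (1 + 4 * q + q\<^sup>2) / (1 - q) ^ 4 = (d + 6) / d\<^sup>2"
    proof -
      have "d + 6 = (1 + 4 * q + q\<^sup>2) / q" using q by (simp add: d_def field_simps power2_eq_square)
      then show ?thesis using q unfolding d_def by (simp add: field_simps power_divide) (simp add: eval_nat_numeral algebra_simps)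
    qed
    also have "\<dots> \<le> 63 / 10 / z\<^sup>2"
    proof -
      define E where "E = 1 + z / 12 + z\<^sup>2 / 360"
      have "E \<le> D" using D by (simp add: E_def)
      have E0: "z / 12 \<le> E" using z by (simp add: E_def)
      \<comment> \<open>If E were only 1 + z / 12, the coefficient of z^2 in 63/10 * E^2 - z * E
        would be negative; the term z^2 / 360 repairs this for large z.\<close>
      have "z * E + 6 \<le> 63 / 10 * E\<^sup>2"
      proof -
        have "63 / 10 * E\<^sup>2 - 6 - z * E =
            3 / 10 + z * (1 / 20 - 11 / 2400 * z + z\<^sup>2 / 7200) + 7 / 144000 * z ^ 4"
          by (simp add: E_def eval_nat_numeral algebra_simps)
        moreover have "0 \<le> z * (1 / 20 - 11 / 2400 * z + z\<^sup>2 / 7200)"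
        proof -
          have "1 / 20 - 11 / 2400 * z + z\<^sup>2 / 7200 = (z - 33 / 2)\<^sup>2 / 7200 + (1 / 20 - (33 / 2)\<^sup>2 / 7200)"
            by (simp add: power2_eq_square field_simps)
          also have "\<dots> \<ge> 0" by (simp add: power2_eq_square)
          finally show ?thesis using z by (intro mult_nonneg_nonneg) auto
        qed
        moreover have "0 \<le> z ^ 4" using z by simp
        ultimately show ?thesis by linarith
      qed
      moreover have "63 / 10 * D\<^sup>2 - z * D - (63 / 10 * E\<^sup>2 - z * E) = (D - E) * (63 / 10 * (D + E) - z)"
        by (simp add: power2_eq_square field_simps)
      moreover have "0 \<le> (D - E) * (63 / 10 * (D + E) - z)"
      proof (rule mult_nonneg_nonneg)
        show "0 \<le> D - E" using \<open>E \<le> D\<close> by simp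
        have "z / 12 + z / 12 \<le> D + E" using \<open>E \<le> D\<close> E0 by linarith
        then show "0 \<le> 63 / 10 * (D + E) - z" using z by (simp add: field_simps)
      qed
      ultimately have "z * D + 6 \<le> 63 / 10 * D\<^sup>2" by linarith
      then have "(z * D + 6) / D\<^sup>2 / z\<^sup>2 \<le> 63 / 10 / z\<^sup>2"
        using z D0 by (intro divide_right_mono) (simp_all add: pos_divide_le_eq)
      then show ?thesis unfolding dz by (simp add: power_mult_distrib mult.commute)
    qed
    finally show ?thesis unfolding pow using sum_powers_geometric_le(4)[OF q, of N]
      by (simp add: z_def flip: power_mult)
  qed
qed

text \<open>The even l carry a quarter of the Basel sum pi^2 / 6. Because of the shift in
  \<open>f\<close> they sit at its odd indices.\<close>

lemma sum_odd_inverse_squares_le: "(\<Sum>l | l \<in> {1..N} \<and> odd l. 1 / real l ^ 2) \<le> pi\<^sup>2 / 8"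
proof -
  define f where "f n = 1 / real (n + 1) ^ 2" for n :: nat
  define h where "h n = (if odd n then f n else 0)" for n
  have f: "f sums (pi\<^sup>2 / 6)" unfolding f_def using inverse_squares_sums by simp
  have "(\<lambda>n. h (2 * n + 1)) sums (1 / 4 * (pi\<^sup>2 / 6))"
  proof -
    have "(\<lambda>n. h (2 * n + 1)) = (\<lambda>n. 1 / 4 * f n)"
      by (rule ext) (simp add: h_def f_def field_simps power2_eq_square)
    then show ?thesis using sums_mult[OF f, of "1 / 4"] by (simp only:)
  qed
  moreover have "(\<lambda>n. h (2 * n + 1)) sums c \<longleftrightarrow> h sums c" for c
    by (rule sums_mono_reindex) (auto simp: h_def strict_mono_def elim!: oddE)
  ultimately have "h sums (1 / 4 * (pi\<^sup>2 / 6))" by blast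
  with f have "(\<lambda>n. f n - h n) sums (pi\<^sup>2 / 6 - 1 / 4 * (pi\<^sup>2 / 6))" by (rule sums_diff)
  moreover have "0 \<le> f n - h n" for n by (simp add: f_def h_def)
  ultimately have "(\<Sum>n<N. f n - h n) \<le> pi\<^sup>2 / 6 - 1 / 4 * (pi\<^sup>2 / 6)"
    by (metis (no_types, lifting) sum_le_suminf sums_iff finite_lessThan)
  also have "(\<Sum>n<N. f n - h n) = (\<Sum>n | n < N \<and> even n. f n)"
    by (rule sum.mono_neutral_cong_right) (auto simp: h_def)
  also have "\<dots> = (\<Sum>l | l \<in> {1..N} \<and> odd l. 1 / real l ^ 2)"
    by (rule sum.reindex_bij_witness[of _ "\<lambda>l. l - 1" Suc]) (auto simp: f_def)
  finally show ?thesis by simp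
qed

text \<open>Write j = l k. Each odd l then sees the plain power sum at l y, and for every
  \<open>i\<close> the powers of l combine to 1 / l^2.\<close>

lemma divisor_weight_moment_le:
  assumes "i \<ge> 1" "y > 0" "C \<ge> 0"
    and C: "\<And>x N. x > 0 \<Longrightarrow> (\<Sum>k<N. real k ^ i * exp (- (real k * x))) \<le> C / x ^ (i + 1)"
  shows "(\<Sum>j<N. divisor_weight j * real j ^ i * exp (- (real j * y))) \<le> C * (pi\<^sup>2 / 4) / y ^ (i + 1)"
proof -
  define F where "F l j = 2 / real l * (real j ^ i * exp (- (real j * y)))" for l j
  have "(\<Sum>j<N. divisor_weight j * real j ^ i * exp (- (real j * y))) =
      (\<Sum>j\<in>{1..<N}. divisor_weight j * real j ^ i * exp (- (real j * y)))"
    using assms(1) by (intro sum.mono_neutral_right) (auto simp: not_less_eq_eq)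
  also have "\<dots> = (\<Sum>j\<in>{1..<N}. \<Sum>l | l \<in> {l\<in>{1..N}. odd l} \<and> l dvd j. F l j)"
  proof (rule sum.cong)
    fix j assume j: "j \<in> {1..<N}"
    have "l \<in> {1..N}" if "l dvd j" for l
      using j that dvd_imp_le[of l j] by (cases l) auto
    then have "{l. l dvd j \<and> odd l} = {l. l \<in> {l\<in>{1..N}. odd l} \<and> l dvd j}" by blast
    then show "divisor_weight j * real j ^ i * exp (- (real j * y)) = (\<Sum>l | l \<in> {l\<in>{1..N}. odd l} \<and> l dvd j. F l j)"
      by (simp add: divisor_weight_def F_def sum_distrib_right mult.assoc)
  qed simp
  also have "\<dots> = (\<Sum>l\<in>{l\<in>{1..N}. odd l}. \<Sum>j | j \<in> {1..<N} \<and> l dvd j. F l j)"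
    by (rule sum.swap_restrict) auto
  also have "\<dots> \<le> (\<Sum>l\<in>{l\<in>{1..N}. odd l}. 2 * C / y ^ (i + 1) * (1 / real l ^ 2))"
  proof (rule sum_mono)
    fix l assume "l \<in> {l\<in>{1..N}. odd l}"
    then have l: "l > 0" by auto
    have "j \<in> (\<lambda>k. l * k) ` {..<N}" if j: "j \<in> {1..<N}" "l dvd j" for j
    proof -
      obtain k where "j = l * k" using j(2) by (auto elim: dvdE)
      moreover from this have "k \<le> j" using l by simp
      then have "k \<in> {..<N}" using j(1) by simp
      ultimately show ?thesis by (rule image_eqI)
    qed
    then have "(\<Sum>j | j \<in> {1..<N} \<and> l dvd j. F l j) \<le> (\<Sum>j\<in>(\<lambda>k. l * k) ` {..<N}. F l j)"
      by (intro sum_mono2) (auto simp: F_def)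
    also have "\<dots> = (\<Sum>k<N. F l (l * k))"
      using l by (subst sum.reindex) (auto simp: inj_on_def)
    also have "\<dots> = 2 / real l * real l ^ i * (\<Sum>k<N. real k ^ i * exp (- (real k * (real l * y))))"
      by (simp add: F_def sum_distrib_left power_mult_distrib ac_simps)
    also have "\<dots> \<le> 2 / real l * real l ^ i * (C / (real l * y) ^ (i + 1))"
      using l assms(2) by (intro mult_left_mono C) auto
    also have "\<dots> = 2 * C / y ^ (i + 1) * (1 / real l ^ 2)"
      using l assms(2) by (simp add: power_mult_distrib field_simps power2_eq_square)
    finally show "(\<Sum>j | j \<in> {1..<N} \<and> l dvd j. F l j) \<le> 2 * C / y ^ (i + 1) * (1 / real l ^ 2)" .
  qed
  also have "\<dots> = 2 * C / y ^ (i + 1) * (\<Sum>l | l \<in> {1..N} \<and> odd l. 1 / real l ^ 2)"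
    by (simp add: sum_distrib_left)
  also have "\<dots> \<le> 2 * C / y ^ (i + 1) * (pi\<^sup>2 / 8)"
    using assms by (intro mult_left_mono sum_odd_inverse_squares_le) auto
  finally show ?thesis by simp
qed

text \<open>Up to sign, the derivative of order \<open>i\<close> of log P (exp (- y)) with respect
  to y.\<close>

definition moment :: "nat \<Rightarrow> real \<Rightarrow> real" where
  "moment i y = (\<Sum>j. divisor_weight j * real j ^ i * exp (- (real j * y)))"

lemma divisor_weight_nonneg: "0 \<le> divisor_weight j"
  by (simp add: divisor_weight_def sum_nonneg)

lemma summable_moment_and_le:
  assumes "i \<ge> 1" "y > 0" "C \<ge> 0"
    and C: "\<And>x N. x > 0 \<Longrightarrow> (\<Sum>k<N. real k ^ i * exp (- (real k * x))) \<le> C / x ^ (i + 1)"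
  shows "summable (\<lambda>j. divisor_weight j * real j ^ i * exp (- (real j * y)))"
    and "moment i y \<le> C * (pi\<^sup>2 / 4) / y ^ (i + 1)"
proof -
  show s: "summable (\<lambda>j. divisor_weight j * real j ^ i * exp (- (real j * y)))"
    by (rule summableI_nonneg_bounded[of _ "C * (pi\<^sup>2 / 4) / y ^ (i + 1)"])
       (use divisor_weight_moment_le[OF assms] divisor_weight_nonneg in auto)
  show "moment i y \<le> C * (pi\<^sup>2 / 4) / y ^ (i + 1)"
    unfolding moment_def by (rule suminf_le_const[OF s divisor_weight_moment_le[OF assms]])
qed

lemma
  assumes "y > 0"
  shows summable_moment_1: "summable (\<lambda>j. divisor_weight j * real j * exp (- (real j * y)))"
    and summable_moment_2: "summable (\<lambda>j. divisor_weight j * real j ^ 2 * exp (- (real j * y)))"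
    and summable_moment_3: "summable (\<lambda>j. divisor_weight j * real j ^ 3 * exp (- (real j * y)))"
    and moment_1_le: "moment 1 y \<le> pi\<^sup>2 / (4 * y\<^sup>2)"
    and moment_2_le: "moment 2 y \<le> pi\<^sup>2 / (2 * y ^ 3)"
    and moment_3_le: "moment 3 y \<le> 63 / 40 * pi\<^sup>2 / y ^ 4"
  using summable_moment_and_le[of 1 y 1] summable_moment_and_le[of 2 y 2]
    summable_moment_and_le[of 3 y "63 / 10"] sum_powers_exp_le assms
  by (simp_all add: power2_eq_square)

section \<open>The coefficients as integrals\<close>

text \<open>Every odd number divides 0, so the defining sum runs over an infinite set and takes the
  default value 0. This is the value wanted, as log P has no constant term.\<close>

lemma divisor_weight_0: "divisor_weight 0 = 0"
proof -
  have "infinite {l :: nat. odd l}"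
    unfolding infinite_nat_iff_unbounded
    by (metis even_Suc lessI less_SucI mem_Collect_eq)
  then show ?thesis by (simp add: divisor_weight_def)
qed

lemma summable_divisor_weight:
  assumes "y > 0"
  shows "summable (\<lambda>j. divisor_weight j * exp (- (real j * y)))"
proof (rule summable_comparison_test'[OF summable_moment_1[OF assms]])
  fix j :: nat
  show "norm (divisor_weight j * exp (- (real j * y))) \<le> divisor_weight j * real j * exp (- (real j * y))"
    using divisor_weight_nonneg[of j] by (cases j) (auto simp: divisor_weight_0 mult_left_mono algebra_simps)
qed

definition weight_fps :: "complex fps" where
  "weight_fps = Abs_fps (\<lambda>j. of_real (divisor_weight j))"

lemma weight_fps_conv_radius: "fps_conv_radius weight_fps \<ge> 1"
  unfolding fps_conv_radius_def
proof (rule conv_radius_geI_ex')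
  fix r :: real assume r: "0 < r" "ereal r < 1"
  then have "r < 1" by (simp add: one_ereal_def)
  then have "summable (\<lambda>j. divisor_weight j * exp (- (real j * - ln r)))"
    using r by (intro summable_divisor_weight) simp
  moreover have "exp (- (real j * - ln r)) = r ^ j" for j
    using r by (simp add: exp_of_nat_mult)
  ultimately have "summable (\<lambda>j. divisor_weight j * r ^ j)" by simp
  then have "summable (\<lambda>j. complex_of_real (divisor_weight j * r ^ j))" by (rule summable_of_real)
  then show "summable (\<lambda>j. fps_nth weight_fps j * of_real r ^ j)"
    by (simp add: weight_fps_def)
qed

text \<open>F = exp W satisfies X F' = X W' * F, which is the recurrence
  \<open>num_overpartitions_rec\<close>, and both sequences start with 1.\<close>

lemma exp_weight_fps_nth: "fps_nth (fps_exp 1 oo weight_fps) n = of_nat (num_overpartitions n)"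
proof (induction n rule: less_induct)
  case (less n)
  define F where "F = fps_exp 1 oo weight_fps"
  have w0: "fps_nth weight_fps 0 = 0" by (simp add: weight_fps_def divisor_weight_0)
  have F': "fps_deriv F = F * fps_deriv weight_fps"
    unfolding F_def by (simp add: fps_compose_deriv[OF w0])
  show ?case
  proof (cases "n = 0")
    case True
    then show ?thesis by (simp add: num_overpartitions_0)
  next
    case False
    have "of_nat n * fps_nth F n = fps_nth (fps_X * fps_deriv F) n"
      using False by (cases n) simp_all
    also have "\<dots> = fps_nth ((fps_X * fps_deriv weight_fps) * F) n"
      by (simp add: F' ac_simps)
    also have "\<dots> = (\<Sum>j=0..n. fps_nth (fps_X * fps_deriv weight_fps) j * fps_nth F (n - j))"
      by (simp add: fps_mult_nth)
    also have "\<dots> = (\<Sum>j=1..n. fps_nth (fps_X * fps_deriv weight_fps) j * fps_nth F (n - j))"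
      by (rule sum.mono_neutral_right) (auto simp: not_less_eq_eq)
    also have "\<dots> = (\<Sum>j=1..n. of_real (real j * divisor_weight j * real (num_overpartitions (n - j))))"
    proof (rule sum.cong)
      fix j assume j: "j \<in> {1..n}"
      then have "fps_nth F (n - j) = of_nat (num_overpartitions (n - j))"
        using less[of "n - j"] by (simp add: F_def)
      moreover have "fps_nth (fps_X * fps_deriv weight_fps) j = of_nat j * of_real (divisor_weight j)"
        using j by (cases j) (simp_all add: weight_fps_def)
      ultimately show "fps_nth (fps_X * fps_deriv weight_fps) j * fps_nth F (n - j) =
          of_real (real j * divisor_weight j * real (num_overpartitions (n - j)))" by simp
    qed simp
    also have "\<dots> = of_real (real n * real (num_overpartitions n))"
      by (simp only: num_overpartitions_rec of_real_sum)
    finally show ?thesis using False by (simp add: F_def)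
  qed
qed

text \<open>Composition gives the expansion near 0; holomorphy on the unit disc carries it to every
  |z| < 1.\<close>

lemma num_overpartitions_sums:
  assumes "norm (z :: complex) < 1"
  shows "(\<lambda>n. of_nat (num_overpartitions n) * z ^ n) sums exp (\<Sum>j. of_real (divisor_weight j) * z ^ j)"
proof -
  have r: "0 < fps_conv_radius weight_fps" 
    by (rule order.strict_trans2[OF _ weight_fps_conv_radius]) simp
  have "(exp \<circ> eval_fps weight_fps) has_fps_expansion (fps_exp 1 oo weight_fps)"
    by (intro has_fps_expansion_compose has_fps_expansion_exp1 eval_fps_has_fps_expansion r)
       (simp add: weight_fps_def divisor_weight_0)
  moreover have "(exp \<circ> eval_fps weight_fps) holomorphic_on eball 0 1"
  proof (intro holomorphic_on_compose holomorphic_on_exp holomorphic_on_eval_fps)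
    show "eball 0 1 \<subseteq> eball 0 (fps_conv_radius weight_fps)"
      using weight_fps_conv_radius by (simp add: eball_mono)
  qed
  ultimately have "(\<lambda>n. fps_nth (fps_exp 1 oo weight_fps) n * z ^ n) sums (exp \<circ> eval_fps weight_fps) z"
    by (rule has_fps_expansion_imp_sums_complex) (use assms in \<open>simp add: one_ereal_def\<close>)
  then show ?thesis
    unfolding exp_weight_fps_nth by (simp add: eval_fps_def weight_fps_def)
qed

text \<open>\<open>log_modulus\<close> and \<open>phase\<close> are the real and imaginary parts of
  log P (exp (- y + i t)). Defining them by the series fixes the branch of the logarithm.\<close>

definition log_modulus :: "real \<Rightarrow> real \<Rightarrow> real" where
  "log_modulus y t = (\<Sum>j. divisor_weight j * exp (- (real j * y)) * cos (real j * t))"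

definition phase :: "real \<Rightarrow> real \<Rightarrow> real" where
  "phase y t = (\<Sum>j. divisor_weight j * exp (- (real j * y)) * sin (real j * t))"

lemma
  assumes "y > 0"
  shows summable_log_modulus: "summable (\<lambda>j. divisor_weight j * exp (- (real j * y)) * cos (real j * t))"
    and summable_phase: "summable (\<lambda>j. divisor_weight j * exp (- (real j * y)) * sin (real j * t))"
  by (rule summable_comparison_test'[OF summable_divisor_weight[OF assms]];
      simp add: abs_mult divisor_weight_nonneg mult_left_le)+

lemma num_overpartitions_cos_sums:
  assumes "y > 0"
  shows "(\<lambda>k. real (num_overpartitions k) * exp (- (real k * y)) * cos (of_int (int k - int n) * t))
     sums (exp (log_modulus y t) * cos (phase y t - real n * t))"
proof -
  define z where "z = complex_of_real (exp (- y)) * cis t"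
  have "norm z < 1" using assms by (simp add: z_def norm_mult)
  have zk: "z ^ k = of_real (exp (- (real k * y))) * cis (real k * t)" for k
    by (simp add: z_def power_mult_distrib Complex.DeMoivre exp_of_nat_mult[symmetric] flip: of_real_power)
  have w: "of_real (divisor_weight j) * z ^ j = Complex (divisor_weight j * exp (- (real j * y)) * cos (real j * t))
      (divisor_weight j * exp (- (real j * y)) * sin (real j * t))" for j
    by (simp add: zk complex_eq_iff)
  have "(\<lambda>j. of_real (divisor_weight j) * z ^ j) sums Complex (log_modulus y t) (phase y t)"
    unfolding w sums_complex_iff log_modulus_def phase_def
    using summable_sums[OF summable_log_modulus[OF assms]] summable_sums[OF summable_phase[OF assms]] by simp
  then have "(\<Sum>j. of_real (divisor_weight j) * z ^ j) = Complex (log_modulus y t) (phase y t)"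
    by (rule sums_unique[symmetric])
  then have "(\<lambda>k. of_nat (num_overpartitions k) * z ^ k * cis (- (real n * t))) sums
      (exp (Complex (log_modulus y t) (phase y t)) * cis (- (real n * t)))"
    using num_overpartitions_sums[OF \<open>norm z < 1\<close>] by (intro sums_mult2) simp
  then have "(\<lambda>k. Re (of_nat (num_overpartitions k) * z ^ k * cis (- (real n * t)))) sums
      Re (exp (Complex (log_modulus y t) (phase y t)) * cis (- (real n * t)))"
    by (rule sums_Re)
  moreover have "Re (of_nat (num_overpartitions k) * z ^ k * cis (- (real n * t))) =
      real (num_overpartitions k) * exp (- (real k * y)) * cos (of_int (int k - int n) * t)" for k
    by (simp add: zk cos_diff algebra_simps)
  moreover have "Re (exp (Complex (log_modulus y t) (phase y t)) * cis (- (real n * t))) =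
      exp (log_modulus y t) * cos (phase y t - real n * t)"
    by (simp add: exp_eq_polar cos_diff algebra_simps)
  ultimately show ?thesis by simp
qed

lemma has_integral_cos_multiple:
  "((\<lambda>t. cos (of_int m * t)) has_integral (if m = 0 then pi else 0)) {0..pi}"
proof (cases "m = 0")
  case True
  then show ?thesis using has_integral_const_real[of "1 :: real" 0 pi] by simp
next
  case False
  have "((\<lambda>t. cos (of_int m * t)) has_integral (sin (of_int m * pi) / of_int m - sin (of_int m * 0) / of_int m)) {0..pi}"
    using False
    by (intro fundamental_theorem_of_calculus)
       (auto intro!: derivative_eq_intros simp flip: has_real_derivative_iff_has_vector_derivative)
  then show ?thesis using False by (simp add: mult.commute[of _ pi])
qed

text \<open>The weight mixes in the frequencies m + 1 and m - 1 with factor - 1/2, so integration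
  extracts minus half a second difference of the coefficients.\<close>

lemma has_integral_cos_multiple_weighted:
  "((\<lambda>t. cos (of_int m * t) * (1 - cos t)) has_integral
     ((if m = 0 then pi else 0) - ((if m = -1 then pi else 0) + (if m = 1 then pi else 0)) / 2)) {0..pi}"
proof -
  have "cos (of_int m * t) * (1 - cos t) =
      cos (of_int m * t) - (cos (of_int (m + 1) * t) + cos (of_int (m - 1) * t)) / 2" for t :: real
    by (simp add: distrib_right left_diff_distrib cos_add cos_diff) (simp add: algebra_simps)
  moreover have "((\<lambda>t. cos (of_int m * t) - (cos (of_int (m + 1) * t) + cos (of_int (m - 1) * t)) / 2) has_integral
      ((if m = 0 then pi else 0) - ((if m + 1 = 0 then pi else 0) + (if m - 1 = 0 then pi else 0)) / 2)) {0..pi}"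
    by (intro has_integral_diff has_integral_divide has_integral_add has_integral_cos_multiple)
  moreover have "m + 1 = 0 \<longleftrightarrow> m = -1" "m - 1 = 0 \<longleftrightarrow> m = 1" by auto
  ultimately show ?thesis by simp
qed

lemma has_integral_second_difference:
  assumes "y > 0" "n \<ge> 1"
  defines "a \<equiv> \<lambda>k. real (num_overpartitions k) * exp (- (real k * y))"
  shows "((\<lambda>t. exp (log_modulus y t) * cos (phase y t - real n * t) * (1 - cos t)) has_integral
     (pi * a n - pi / 2 * (a (n + 1) + a (n - 1)))) {0..pi}"
proof -
  define f where "f k t = a k * cos (of_int (int k - int n) * t) * (1 - cos t)" for k t
  have a0: "0 \<le> a k" for k by (simp add: a_def)
  have sum_a: "summable a"
    using num_overpartitions_cos_sums[OF assms(1), of 0 0] by (simp add: a_def sums_iff)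
  have bound: "norm (f k t) \<le> 2 * a k" for k t
  proof -
    have "\<bar>cos (of_int (int k - int n) * t)\<bar> * \<bar>1 - cos t\<bar> \<le> 1 * 2"
    proof (rule mult_mono)
      show "\<bar>1 - cos t\<bar> \<le> 2" using cos_le_one[of t] cos_ge_minus_one[of t] by linarith
    qed auto
    then show ?thesis using a0[of k] mult_left_mono[of _ 2 "a k"]
      by (simp add: f_def abs_mult mult.assoc mult.commute[of 2])
  qed
  have "uniform_limit {0..pi} (\<lambda>N t. \<Sum>k<N. f k t) (\<lambda>t. \<Sum>k. f k t) sequentially"
    by (rule Weierstrass_m_test[of _ _ "\<lambda>k. 2 * a k"]) (use bound sum_a in \<open>auto intro: summable_mult\<close>)
  moreover have "(\<Sum>k. f k t) = exp (log_modulus y t) * cos (phase y t - real n * t) * (1 - cos t)" for t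
    unfolding f_def a_def
    by (rule sums_unique[symmetric], rule sums_mult2, rule num_overpartitions_cos_sums[OF assms(1)])
  ultimately have lim: "uniform_limit {0..pi} (\<lambda>N t. \<Sum>k<N. f k t)
      (\<lambda>t. exp (log_modulus y t) * cos (phase y t - real n * t) * (1 - cos t)) sequentially"
    by simp
  have cont: "continuous_on {0..pi} (\<lambda>t. \<Sum>k<N. f k t)" for N
    unfolding f_def by (intro continuous_intros)
  obtain I J where I: "\<And>N. ((\<lambda>t. \<Sum>k<N. f k t) has_integral I N) {0..pi}"
    and J: "((\<lambda>t. exp (log_modulus y t) * cos (phase y t - real n * t) * (1 - cos t)) has_integral J) {0..pi}"
    and IJ: "I \<longlonglongrightarrow> J"
    using uniform_limit_integral[OF lim cont] by auto
  let ?v = "\<lambda>k. a k * ((if int k - int n = 0 then pi else 0) -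
      ((if int k - int n = -1 then pi else 0) + (if int k - int n = 1 then pi else 0)) / 2)"
  \<comment> \<open>Only the frequencies k = n - 1, n, n + 1 survive, so the integrals of the
    partial sums are constant once these are included.\<close>
  have "I N = pi * a n - pi / 2 * (a (n + 1) + a (n - 1))" if "N \<ge> n + 2" for N
  proof -
    have "((\<lambda>t. \<Sum>k<N. f k t) has_integral (\<Sum>k<N. ?v k)) {0..pi}"
      unfolding f_def mult.assoc
      by (intro has_integral_sum has_integral_mult_right has_integral_cos_multiple_weighted) auto
    then have "I N = (\<Sum>k<N. ?v k)" using I has_integral_unique by blast
    also have "\<dots> = (\<Sum>k\<in>{n - 1, n, n + 1}. ?v k)"
      using that assms(2) by (intro sum.mono_neutral_right) auto
    also have "\<dots> = pi * a n - pi / 2 * (a (n + 1) + a (n - 1))"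
      using assms(2) by (cases n) (auto simp: algebra_simps add_divide_distrib)
    finally show ?thesis .
  qed
  then have "eventually (\<lambda>N. I N = pi * a n - pi / 2 * (a (n + 1) + a (n - 1))) sequentially"
    by (auto simp: eventually_at_top_linorder)
  then have "I \<longlonglongrightarrow> pi * a n - pi / 2 * (a (n + 1) + a (n - 1))"
    by (rule tendsto_eventually)
  then show ?thesis using IJ J LIMSEQ_unique by blast
qed

lemma log_concave_of_integral_nonneg:
  assumes "y > 0" "n \<ge> 1"
    and "0 \<le> integral {0..pi} (\<lambda>t. exp (log_modulus y t) * cos (phase y t - real n * t) * (1 - cos t))"
  shows "num_overpartitions (n + 1) * num_overpartitions (n - 1) \<le> (num_overpartitions n)\<^sup>2"
proof -
  define a where "a k = real (num_overpartitions k) * exp (- (real k * y))" for k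
  have "0 \<le> pi * a n - pi / 2 * (a (n + 1) + a (n - 1))"
    using assms has_integral_second_difference[OF assms(1,2)] by (simp add: a_def integral_unique)
  also have "\<dots> = pi * (a n - (a (n + 1) + a (n - 1)) / 2)" by (simp add: algebra_simps)
  finally have "(a (n + 1) + a (n - 1)) / 2 \<le> a n"
    using pi_gt_zero by (auto simp: zero_le_mult_iff)
  moreover have "0 \<le> a k" for k by (simp add: a_def)
  moreover have "a (n + 1) * a (n - 1) \<le> ((a (n + 1) + a (n - 1)) / 2)\<^sup>2"
    using sum_squares_bound[of "a (n + 1)" "a (n - 1)"] by (simp add: power2_eq_square field_simps)
  ultimately have "a (n + 1) * a (n - 1) \<le> (a n)\<^sup>2"
    by (smt (verit) power_mono divide_nonneg_nonneg)
  moreover have "a (n + 1) * a (n - 1) =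
      real (num_overpartitions (n + 1) * num_overpartitions (n - 1)) * exp (- (real (2 * n) * y))"
  proof -
    have "exp (- (real (n + 1) * y)) * exp (- (real (n - 1) * y)) = exp (- (real (2 * n) * y))"
      unfolding mult_exp_exp using assms(2) by (simp add: of_nat_diff algebra_simps)
    then show ?thesis by (simp add: a_def)
  qed
  moreover have "(a n)\<^sup>2 = real ((num_overpartitions n)\<^sup>2) * exp (- (real (2 * n) * y))"
    by (simp add: a_def power_mult_distrib mult.assoc flip: exp_double)
  ultimately have "real (num_overpartitions (n + 1) * num_overpartitions (n - 1)) \<le> real ((num_overpartitions n)\<^sup>2)"
    by (metis exp_gt_zero mult_le_cancel_right_pos)
  then show ?thesis by (simp only: of_nat_le_iff)
qed

section \<open>Estimates for phase and modulus\<close>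

lemma cubic_le_sin:
  fixes x :: real
  assumes "0 \<le> x"
  shows "x - x ^ 3 / 6 \<le> sin x"
proof -
  have cos: "1 - x\<^sup>2 / 2 \<le> cos x" if "0 \<le> x" for x :: real
  proof -
    have "cos 0 - (1 - 0\<^sup>2 / 2) \<le> cos x - (1 - x\<^sup>2 / 2)"
    proof (rule DERIV_nonneg_imp_nondecreasing[OF that])
      fix u :: real assume "0 \<le> u"
      have "((\<lambda>u. cos u - (1 - u\<^sup>2 / 2)) has_real_derivative (u - sin u)) (at u)"
        by (auto intro!: derivative_eq_intros)
      then show "\<exists>D. ((\<lambda>u. cos u - (1 - u\<^sup>2 / 2)) has_real_derivative D) (at u) \<and> 0 \<le> D"
        using sin_x_le_x[OF \<open>0 \<le> u\<close>] by force
    qed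
    then show ?thesis by simp
  qed
  have "sin 0 - (0 - 0 ^ 3 / 6) \<le> sin x - (x - x ^ 3 / 6)"
  proof (rule DERIV_nonneg_imp_nondecreasing[OF assms])
    fix u :: real assume "0 \<le> u"
    have "((\<lambda>u. sin u - (u - u ^ 3 / 6)) has_real_derivative (cos u - (1 - u\<^sup>2 / 2))) (at u)"
      by (auto intro!: derivative_eq_intros simp: power2_eq_square)
    then show "\<exists>D. ((\<lambda>u. sin u - (u - u ^ 3 / 6)) has_real_derivative D) (at u) \<and> 0 \<le> D"
      using cos[OF \<open>0 \<le> u\<close>] by force
  qed
  then show ?thesis by simp
qed

lemma cos_eq_sin_half: "1 - cos x = 2 * (sin (x / 2))\<^sup>2" for x :: real
  using cos_double_sin[of "x / 2"] by simp

lemma one_minus_cos_le: "1 - cos x \<le> x\<^sup>2 / 2" for x :: real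
proof -
  have "\<bar>sin (x / 2)\<bar>\<^sup>2 \<le> \<bar>x / 2\<bar>\<^sup>2" by (intro power_mono abs_sin_x_le_abs_x) simp
  then show ?thesis by (simp add: cos_eq_sin_half power2_eq_square)
qed

lemma one_minus_cos_ge:
  fixes x :: real
  assumes "0 \<le> x" "x \<le> 1 / 8"
  shows "499 / 1000 * x\<^sup>2 \<le> 1 - cos x"
proof -
  have "x / 2 * (1 - x\<^sup>2 / 24) \<le> sin (x / 2)"
    using cubic_le_sin[of "x / 2"] assms by (simp add: power2_eq_square power3_eq_cube algebra_simps)
  moreover have x2: "x\<^sup>2 \<le> 1 / 64" using power_mono[OF assms(2,1), of 2] by (simp add: power2_eq_square)
  ultimately have "(x / 2 * (1 - x\<^sup>2 / 24))\<^sup>2 \<le> (sin (x / 2))\<^sup>2"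
    using assms by (intro power_mono mult_nonneg_nonneg) auto
  moreover have "998 / 1000 \<le> (1 - x\<^sup>2 / 24)\<^sup>2"
  proof -
    \<comment> \<open>1535 / 1536 is the value of 1 - x^2 / 24 at x = 1/8.\<close>
    have "998 / 1000 \<le> (1535 / 1536 :: real)\<^sup>2" by (simp add: power2_eq_square)
    also have "\<dots> \<le> (1 - x\<^sup>2 / 24)\<^sup>2" using x2 by (intro power_mono) auto
    finally show ?thesis .
  qed
  then have "998 / 1000 * (x\<^sup>2 / 4) \<le> (1 - x\<^sup>2 / 24)\<^sup>2 * (x\<^sup>2 / 4)" by (intro mult_right_mono) auto
  moreover have "(1 - x\<^sup>2 / 24)\<^sup>2 * (x\<^sup>2 / 4) = (x / 2 * (1 - x\<^sup>2 / 24))\<^sup>2"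
    by (simp add: power_mult_distrib power_divide)
  ultimately show ?thesis unfolding cos_eq_sin_half by linarith
qed

text \<open>This is tanh (y / 2) \<le> y / 2, cleared of denominators.\<close>

lemma one_minus_exp_le:
  fixes y :: real
  assumes "0 \<le> y"
  shows "2 * (1 - exp (- y)) \<le> y * (1 + exp (- y))"
proof -
  have "0 * (1 + exp (- 0)) - 2 * (1 - exp (- 0)) \<le> y * (1 + exp (- y)) - 2 * (1 - exp (- y))"
  proof (rule DERIV_nonneg_imp_nondecreasing[OF assms])
    fix u :: real
    have "((\<lambda>u. u * (1 + exp (- u)) - 2 * (1 - exp (- u))) has_real_derivative (1 - (1 + u) * exp (- u))) (at u)"
      by (auto intro!: derivative_eq_intros simp: algebra_simps)
    moreover have "(1 + u) * exp (- u) \<le> 1"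
      using exp_ge_add_one_self[of u] by (simp add: exp_minus field_simps)
    ultimately show "\<exists>D. ((\<lambda>u. u * (1 + exp (- u)) - 2 * (1 - exp (- u))) has_real_derivative D) (at u) \<and> 0 \<le> D"
      by force
  qed
  then show ?thesis by simp
qed

section \<open>Phase and modulus near t = 0 in terms of moments\<close>

lemma moment_1_eq: "moment 1 y = (\<Sum>j. divisor_weight j * real j * exp (- (real j * y)))"
  by (simp add: moment_def)

lemma phase_le:
  assumes "y > 0" "0 \<le> t"
  shows "phase y t \<le> moment 1 y * t"
proof -
  have "phase y t \<le> (\<Sum>j. divisor_weight j * real j * exp (- (real j * y)) * t)"
    unfolding phase_def
  proof (intro suminf_le summable_phase summable_mult2 summable_moment_1 assms(1))
    fix j
    have "divisor_weight j * exp (- (real j * y)) * sin (real j * t) \<le> divisor_weight j * exp (- (real j * y)) * (real j * t)"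
      using assms by (intro mult_left_mono sin_x_le_x) (auto simp: divisor_weight_nonneg)
    then show "divisor_weight j * exp (- (real j * y)) * sin (real j * t) \<le> divisor_weight j * real j * exp (- (real j * y)) * t"
      by (simp add: ac_simps)
  qed
  then show ?thesis
    unfolding moment_1_eq using suminf_mult2[OF summable_moment_1[OF assms(1)], of t] by simp
qed

lemma phase_ge:
  assumes "y > 0" "0 \<le> t"
  shows "moment 1 y * t - moment 3 y * t ^ 3 / 6 \<le> phase y t"
proof -
  have "(\<lambda>j. divisor_weight j * real j * exp (- (real j * y)) * t - divisor_weight j * real j ^ 3 * exp (- (real j * y)) * (t ^ 3 / 6))
      sums (moment 1 y * t - moment 3 y * (t ^ 3 / 6))"
    unfolding moment_1_eq unfolding moment_def
    by (intro sums_diff sums_mult2 summable_sums summable_moment_1 summable_moment_3 assms)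
  moreover have "(\<lambda>j. divisor_weight j * exp (- (real j * y)) * sin (real j * t)) sums phase y t"
    unfolding phase_def by (intro summable_sums summable_phase assms)
  moreover have "divisor_weight j * real j * exp (- (real j * y)) * t - divisor_weight j * real j ^ 3 * exp (- (real j * y)) * (t ^ 3 / 6)
      \<le> divisor_weight j * exp (- (real j * y)) * sin (real j * t)" for j
  proof -
    have "divisor_weight j * exp (- (real j * y)) * (real j * t - (real j * t) ^ 3 / 6) \<le> divisor_weight j * exp (- (real j * y)) * sin (real j * t)"
      using assms by (intro mult_left_mono cubic_le_sin) (auto simp: divisor_weight_nonneg)
    then show ?thesis by (simp add: power_mult_distrib algebra_simps)
  qed
  ultimately have "moment 1 y * t - moment 3 y * (t ^ 3 / 6) \<le> phase y t" by (rule sums_le[rotated])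
  then show ?thesis by simp
qed

lemma log_modulus_sums:
  assumes "y > 0"
  shows "(\<lambda>j. divisor_weight j * exp (- (real j * y)) * (1 - cos (real j * t))) sums
     (log_modulus y 0 - log_modulus y t)"
proof -
  have "(\<lambda>j. divisor_weight j * exp (- (real j * y)) * cos (real j * 0) - divisor_weight j * exp (- (real j * y)) * cos (real j * t)) sums
     (log_modulus y 0 - log_modulus y t)"
    unfolding log_modulus_def by (intro sums_diff summable_sums summable_log_modulus assms)
  then show ?thesis by (simp add: algebra_simps)
qed

lemma log_modulus_diff_le:
  assumes "y > 0"
  shows "log_modulus y 0 - log_modulus y t \<le> moment 2 y * t\<^sup>2 / 2"
proof -
  have "(\<lambda>j. divisor_weight j * real j ^ 2 * exp (- (real j * y)) * (t\<^sup>2 / 2)) sums (moment 2 y * (t\<^sup>2 / 2))"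
    unfolding moment_def by (intro sums_mult2 summable_sums summable_moment_2 assms)
  moreover have "divisor_weight j * exp (- (real j * y)) * (1 - cos (real j * t)) \<le>
      divisor_weight j * real j ^ 2 * exp (- (real j * y)) * (t\<^sup>2 / 2)" for j
  proof -
    have "divisor_weight j * exp (- (real j * y)) * (1 - cos (real j * t)) \<le> divisor_weight j * exp (- (real j * y)) * ((real j * t)\<^sup>2 / 2)"
      by (intro mult_left_mono one_minus_cos_le) (auto simp: divisor_weight_nonneg)
    then show ?thesis by (simp add: power_mult_distrib ac_simps)
  qed
  ultimately have "log_modulus y 0 - log_modulus y t \<le> moment 2 y * (t\<^sup>2 / 2)"
    by (intro sums_le[OF _ log_modulus_sums[OF assms]])
  then show ?thesis by simp
qed

section \<open>Decay of the modulus away from t = 0\<close>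

lemma divisor_weight_ge: "j \<ge> 1 \<Longrightarrow> 2 \<le> divisor_weight j"
proof -
  assume "j \<ge> 1"
  then have "finite {l. l dvd j \<and> odd l}" by (auto intro: finite_subset[of _ "{l. l dvd j}"] finite_divisors_nat)
  then have "(\<Sum>l\<in>{1}. 2 / real l) \<le> divisor_weight j"
    unfolding divisor_weight_def by (intro sum_mono2) auto
  then show ?thesis by simp
qed

text \<open>The real part of 1 / (1 - q) - 1 / (1 - z) with z = q exp (i t); the bracket in the
  denominator is |1 - z|^2.\<close>

lemma geometric_cos_sums:
  fixes q t :: real
  assumes "0 < q" "q < 1"
  shows "(\<lambda>j. q ^ j * (1 - cos (real j * t))) sums
     (q * (1 + q) * (1 - cos t) / ((1 - q) * ((1 - q)\<^sup>2 + 2 * q * (1 - cos t))))"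
proof -
  define z where "z = complex_of_real q * cis t"
  have "norm z < 1" using assms by (simp add: z_def norm_mult)
  then have "(\<lambda>j. z ^ j) sums (1 / (1 - z))" by (rule geometric_sums)
  then have "(\<lambda>j. Re (z ^ j)) sums Re (1 / (1 - z))" by (rule sums_Re)
  moreover have "Re (z ^ j) = q ^ j * cos (real j * t)" for j
    by (simp add: z_def power_mult_distrib Complex.DeMoivre flip: of_real_power)
  moreover define D where "D = (1 - q)\<^sup>2 + 2 * q * (1 - cos t)"
  have D: "(1 - q * cos t)\<^sup>2 + (q * sin t)\<^sup>2 = D"
  proof -
    have *: "(1 - q * c)\<^sup>2 + (q * s)\<^sup>2 = 1 - 2 * q * c + q\<^sup>2 * (s\<^sup>2 + c\<^sup>2)" for c s
      by (simp add: power2_eq_square algebra_simps)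
    then show ?thesis
      unfolding *[of "cos t" "sin t"] sin_cos_squared_add by (simp add: D_def power2_eq_square algebra_simps)
  qed
  then have "Re (1 / (1 - z)) = (1 - q * cos t) / D"
    using D by (simp add: z_def Re_divide)
  ultimately have "(\<lambda>j. q ^ j - q ^ j * cos (real j * t)) sums (1 / (1 - q) - (1 - q * cos t) / D)"
    using geometric_sums[of q] assms by (intro sums_diff) auto
  moreover have "D > 0" using assms cos_le_one[of t] unfolding D_def
    by (intro add_pos_nonneg mult_nonneg_nonneg) auto
  then have "1 / (1 - q) - (1 - q * cos t) / D = q * (1 + q) * (1 - cos t) / ((1 - q) * D)"
    using assms by (simp add: field_simps) (simp add: D_def power2_eq_square algebra_simps)
  ultimately show ?thesis by (simp add: D_def algebra_simps)
qed

lemma pi_squared_bounds: "98695 / 10000 \<le> pi\<^sup>2" "pi\<^sup>2 \<le> 98697 / 10000"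
proof -
  have "3.14159\<^sup>2 \<le> pi\<^sup>2" using pi_approx by (intro power_mono) auto
  then show "98695 / 10000 \<le> pi\<^sup>2" by (simp add: power2_eq_square)
  have "pi\<^sup>2 \<le> 3.1415926535899\<^sup>2" using pi_approx by (intro power_mono) auto
  then show "pi\<^sup>2 \<le> 98697 / 10000" by (simp add: power2_eq_square)
qed

text \<open>Only the odd divisor \<open>1\<close> is used here, which costs the factor \<open>8 / \<pi>\<^sup>2\<close>.\<close>

lemma log_modulus_diff_ge_geometric:
  fixes y t :: real
  assumes "y > 0"
  defines "q \<equiv> exp (- y)"
  shows "2 * (q * (1 + q) * (1 - cos t) / ((1 - q) * ((1 - q)\<^sup>2 + 2 * q * (1 - cos t)))) \<le>
     log_modulus y 0 - log_modulus y t"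
proof -
  have q: "0 < q" "q < 1" using assms by (auto simp: q_def)
  have "2 * (q ^ j * (1 - cos (real j * t))) \<le> divisor_weight j * exp (- (real j * y)) * (1 - cos (real j * t))" for j
  proof (cases "j = 0")
    case False
    have "2 * (exp (- (real j * y)) * (1 - cos (real j * t))) \<le> divisor_weight j * (exp (- (real j * y)) * (1 - cos (real j * t)))"
      using False by (intro mult_right_mono divisor_weight_ge) auto
    moreover have "q ^ j = exp (- (real j * y))" by (simp add: q_def flip: exp_of_nat_mult)
    ultimately show ?thesis by (simp add: mult.assoc)
  qed simp
  then show ?thesis
    by (rule sums_le[OF _ sums_mult[OF geometric_cos_sums[OF q]] log_modulus_sums[OF assms(1)]])
qed

text \<open>The geometric bound is (1 + q) / (1 - q) * w / (r + w) with r = 4 sinh^2 (y / 2) and w =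
  4 sin^2 (t / 2). It grows with w, so t may be replaced by s, and for small y it is about (2 / y) *
  s^2 / (y^2 + s^2), where 2 / y is 8 / pi^2 times pi^2 / (4 y). Lowering 8 / pi^2 to 4/5 pays for
  the approximations of r, w and pi.\<close>

lemma log_modulus_diff_ge:
  fixes y t s :: real
  assumes y: "0 < y" "y \<le> 1 / 16" and s: "0 \<le> s" "s \<le> 2 * y" and t: "s \<le> t" "t \<le> pi"
  shows "4 / 5 * (pi\<^sup>2 / (4 * y)) * (s\<^sup>2 / (y\<^sup>2 + s\<^sup>2)) \<le> log_modulus y 0 - log_modulus y t"
proof -
  define q where "q = exp (- y)"
  have q: "0 < q" "q < 1" using y by (auto simp: q_def)
  define r where "r = (1 - q)\<^sup>2 / q"
  define w where "w = 2 * (1 - cos t)"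
  have r0: "r > 0" using q by (simp add: r_def)
  have qy: "2 * (1 - q) \<le> y * (1 + q)" using one_minus_exp_le[of y] y by (simp add: q_def)
  have "(2 * (1 - q))\<^sup>2 \<le> (y * (1 + q))\<^sup>2" using qy q by (intro power_mono) auto
  then have "(2 * (1 - q))\<^sup>2 / q \<le> (y * (1 + q))\<^sup>2 / q" using q by (intro divide_right_mono) auto
  moreover have "(2 * (1 - q))\<^sup>2 / q = 4 * r" "(y * (1 + q))\<^sup>2 / q = y\<^sup>2 * (r + 4)"
    using q by (simp_all add: r_def field_simps power2_eq_square)
  ultimately have "4 * r \<le> y\<^sup>2 * (r + 4)" by simp
  moreover have "y\<^sup>2 \<le> 1 / 256" using power_mono[of y "1/16" 2] y by (simp add: power2_eq_square)
  then have "y\<^sup>2 * r \<le> 1 / 256 * r" using r0 by (intro mult_right_mono) auto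
  ultimately have r: "r \<le> 1001 / 1000 * y\<^sup>2"
    using zero_le_power2[of y] unfolding distrib_left by linarith
  have w: "998 / 1000 * s\<^sup>2 \<le> w"
  proof -
    have "499 / 1000 * s\<^sup>2 \<le> 1 - cos s" using s y by (intro one_minus_cos_ge) auto
    moreover have "cos t \<le> cos s" using s t by (intro cos_monotone_0_pi_le) auto
    ultimately show ?thesis by (simp add: w_def)
  qed
  have w0: "0 \<le> w" by (simp add: w_def)
  have "4 / 5 * (pi\<^sup>2 / (4 * y)) * (s\<^sup>2 / (y\<^sup>2 + s\<^sup>2)) \<le> 2 / y * (w / (r + w))"
  proof (cases "s = 0")
    case True
    then show ?thesis using r0 w0 y by simp
  next
    case False
    then have s2: "0 < s\<^sup>2" by simp
    have y2: "0 < y\<^sup>2" using y by simp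
    \<comment> \<open>This constant is 4/5 of the upper bound for pi^2 / 8: the target measured in
      units of 2 / y.\<close>
    have "98697 / 100000 * (s\<^sup>2 / (y\<^sup>2 + s\<^sup>2)) \<le> 998 / 1000 * s\<^sup>2 / (1001 / 1000 * y\<^sup>2 + 998 / 1000 * s\<^sup>2)"
    proof -
      have "98697 / 100000 * (1001 / 1000 * y\<^sup>2 + 998 / 1000 * s\<^sup>2) \<le> 998 / 1000 * (y\<^sup>2 + s\<^sup>2)"
        using s2 y2 by simp
      then have "98697 / 100000 * (1001 / 1000 * y\<^sup>2 + 998 / 1000 * s\<^sup>2) * s\<^sup>2 \<le> 998 / 1000 * (y\<^sup>2 + s\<^sup>2) * s\<^sup>2"
        using s2 by (intro mult_right_mono) auto
      then have "98697 / 100000 * (1001 / 1000 * y\<^sup>2 + 998 / 1000 * s\<^sup>2) * s\<^sup>2 / (y\<^sup>2 + s\<^sup>2) \<le> 998 / 1000 * s\<^sup>2"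
        using s2 y2 by (subst pos_divide_le_eq) (simp_all only: add_pos_pos ac_simps)
      moreover have eq: "c * (u / v) * w = c * w * u / v" for c u v w :: real by simp
      ultimately have "98697 / 100000 * (s\<^sup>2 / (y\<^sup>2 + s\<^sup>2)) * (1001 / 1000 * y\<^sup>2 + 998 / 1000 * s\<^sup>2) \<le> 998 / 1000 * s\<^sup>2"
        by (simp only: eq)
      moreover have "0 < 1001 / 1000 * y\<^sup>2 + 998 / 1000 * s\<^sup>2" using s2 y2 by linarith
      ultimately show ?thesis by (rule mult_imp_le_div_pos[rotated])
    qed
    also have "998 / 1000 * s\<^sup>2 / (1001 / 1000 * y\<^sup>2 + 998 / 1000 * s\<^sup>2) \<le> w / (r + w)"
    proof -
      have "998 / 1000 * s\<^sup>2 * r \<le> w * (1001 / 1000 * y\<^sup>2)"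
        using r w r0 w0 by (intro mult_mono) linarith+
      moreover have "0 < w" using w s2 by linarith
      moreover have "0 < 1001 / 1000 * y\<^sup>2 + 998 / 1000 * s\<^sup>2" using s2 y2 by linarith
      ultimately show ?thesis using r0 by (simp add: frac_le_eq divide_le_0_iff) (simp add: algebra_simps)
    qed
    finally have *: "98697 / 100000 * (s\<^sup>2 / (y\<^sup>2 + s\<^sup>2)) \<le> w / (r + w)" .
    have "4 / 5 * (pi\<^sup>2 / (4 * y)) * (s\<^sup>2 / (y\<^sup>2 + s\<^sup>2)) \<le> 4 / 5 * (98697 / 10000 / (4 * y)) * (s\<^sup>2 / (y\<^sup>2 + s\<^sup>2))"
      using y pi_squared_bounds(2) by (intro mult_right_mono mult_left_mono divide_right_mono) auto
    also have "4 / 5 * (98697 / 10000 / (4 * y)) * x = 2 / y * (98697 / 100000 * x)" for x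
      by simp
    also have "2 / y * (98697 / 100000 * (s\<^sup>2 / (y\<^sup>2 + s\<^sup>2))) \<le> 2 / y * (w / (r + w))"
      using y * by (intro mult_left_mono) auto
    finally show ?thesis .
  qed
  also have "2 / y * (w / (r + w)) \<le> (1 + q) / (1 - q) * (w / (r + w))"
    using qy q y r0 w0 by (intro mult_right_mono) (auto simp: field_simps)
  also have "\<dots> = 2 * (q * (1 + q) * (1 - cos t) / ((1 - q) * ((1 - q)\<^sup>2 + 2 * q * (1 - cos t))))"
  proof -
    have "w / (r + w) = q * w / ((1 - q)\<^sup>2 + q * w)" using q by (simp add: r_def field_simps)
    moreover have "1 - cos t = w / 2" by (simp add: w_def)
    moreover have "(1 + q) / b * (q * w / c) = 2 * (q * (1 + q) * (w / 2) / (b * c))" for b c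
    proof -
      have "2 * (x * (w / 2) / d) = x * w / d" for x d by simp
      then have "2 * (q * (1 + q) * (w / 2) / (b * c)) = q * (1 + q) * w / (b * c)" .
      then show ?thesis by (simp only: times_divide_times_eq ac_simps)
    qed
    moreover have "2 * q * (w / 2) = q * w" by simp
    ultimately show ?thesis by (simp only:)
  qed
  also have "\<dots> \<le> log_modulus y 0 - log_modulus y t"
    unfolding q_def by (rule log_modulus_diff_ge_geometric[OF y(1)])
  finally show ?thesis .
qed

section \<open>Existence of the saddle point\<close>

lemma continuous_on_moment_1:
  assumes "0 < b"
  shows "continuous_on {b..c} (moment 1)"
proof -
  have "uniform_limit {b..c} (\<lambda>N y. \<Sum>j<N. divisor_weight j * real j * exp (- (real j * y)))
      (\<lambda>y. \<Sum>j. divisor_weight j * real j * exp (- (real j * y))) sequentially"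
    by (rule Weierstrass_m_test[OF _ summable_moment_1[OF assms]])
       (auto simp: abs_mult divisor_weight_nonneg intro!: mult_left_mono)
  then have "continuous_on {b..c} (\<lambda>y. \<Sum>j. divisor_weight j * real j * exp (- (real j * y)))"
    by (rule uniform_limit_theorem[rotated]) (auto intro!: always_eventually continuous_intros)
  moreover have "moment 1 = (\<lambda>y. \<Sum>j. divisor_weight j * real j * exp (- (real j * y)))"
    by (rule ext) (rule moment_1_eq)
  ultimately show ?thesis by (simp only:)
qed

text \<open>Keeps only the divisor 1 in each weight. The true order is pi^2 / (4 y^2), but the
  weaker constant suffices for an endpoint of the intermediate value argument.\<close>

lemma moment_1_ge:
  assumes "0 < y" "y \<le> 1 / 2"
  shows "1 / y\<^sup>2 \<le> moment 1 y"
proof -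
  define q where "q = exp (- y)"
  have q: "0 < q" "q < 1" "1 - y \<le> q" using assms exp_ge_add_one_self[of "- y"] by (auto simp: q_def)
  have "(\<lambda>j. 2 * q * (of_nat (Suc j) * q ^ j)) sums (2 * q * (1 / (1 - q)\<^sup>2))"
    using q by (intro sums_mult geometric_deriv_sums) auto
  moreover have "(\<lambda>j. divisor_weight (Suc j) * real (Suc j) * exp (- (real (Suc j) * y))) sums moment 1 y"
    unfolding moment_1_eq by (subst sums_Suc_iff) (use summable_sums[OF summable_moment_1[OF assms(1)]] in simp)
  moreover have "2 * q * (of_nat (Suc j) * q ^ j) \<le> divisor_weight (Suc j) * real (Suc j) * exp (- (real (Suc j) * y))" for j
  proof -
    have "exp (- (real (Suc j) * y)) = q ^ Suc j" unfolding q_def exp_of_nat_mult[symmetric] by simp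
    moreover have "2 * (real (Suc j) * q ^ Suc j) \<le> divisor_weight (Suc j) * (real (Suc j) * q ^ Suc j)"
      using q by (intro mult_right_mono divisor_weight_ge) auto
    moreover have "2 * q * (of_nat (Suc j) * q ^ j) = 2 * (real (Suc j) * q ^ Suc j)"
      by (simp only: power_Suc ac_simps)
    ultimately show ?thesis by (simp only: mult.assoc)
  qed
  ultimately have "2 * q * (1 / (1 - q)\<^sup>2) \<le> moment 1 y"
    by (rule sums_le[rotated])
  moreover have "1 * (1 / y\<^sup>2) \<le> 2 * q * (1 / (1 - q)\<^sup>2)"
  proof (rule mult_mono)
    have "(1 - q)\<^sup>2 \<le> y\<^sup>2" using q by (intro power_mono) auto
    then show "1 / y\<^sup>2 \<le> 1 / (1 - q)\<^sup>2" using q by (intro divide_left_mono) (auto simp: assms)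
  qed (use q assms in auto)
  ultimately show ?thesis by linarith
qed

lemma exists_saddle_point:
  fixes n :: nat
  assumes "n \<ge> 1"
  obtains y where "0 < y" "moment 1 y = real n + 7 / 2 / y"
proof -
  \<comment> \<open>With N = n + 7/2 the moment at b = 1 / (2 N) is at least 4 N^2, the shift is 7
    N, and N \<ge> 7/2 leaves at least 7 N.\<close>
  define b where "b = 1 / (2 * (real n + 7 / 2))"
  have b: "0 < b" "b \<le> 1" "b \<le> 1 / 2" by (auto simp: b_def field_simps)
  have "\<exists>y\<ge>b. y \<le> 1 \<and> moment 1 y - 7 / 2 / y = real n"
  proof (rule IVT2')
    have "moment 1 1 \<le> pi\<^sup>2 / 4" using moment_1_le[of 1] by simp
    also have "pi\<^sup>2 \<le> 4\<^sup>2" using pi_less_4 by (intro power_mono) auto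
    finally show "moment 1 1 - 7 / 2 / 1 \<le> real n" using assms by simp
    have "1 / b\<^sup>2 \<le> moment 1 b" by (rule moment_1_ge) (use b in auto)
    moreover define N where "N = real n + 7 / 2"
    have "1 / b\<^sup>2 = 4 * N * N" "7 / 2 / b = 7 * N" by (simp_all add: b_def N_def power2_eq_square field_simps)
    moreover have "14 * N \<le> 4 * N * N" by (intro mult_right_mono) (auto simp: N_def)
    moreover have "real n \<le> 7 * N" by (simp add: N_def)
    ultimately show "real n \<le> moment 1 b - 7 / 2 / b" by linarith
    show "continuous_on {b..1} (\<lambda>y. moment 1 y - 7 / 2 / y)"
      using b by (intro continuous_intros continuous_on_moment_1) auto
  qed (use b in auto)
  then obtain y where "b \<le> y" "moment 1 y - 7 / 2 / y = real n" by blast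
  then show ?thesis using b by (intro that[of y]) linarith+
qed

section \<open>The integral at the saddle point\<close>

lemma integral_ge_of_antiderivative:
  fixes f F p :: "real \<Rightarrow> real"
  assumes "a \<le> b" "f integrable_on {a..b}"
    and "\<And>x. a \<le> x \<Longrightarrow> x \<le> b \<Longrightarrow> (F has_real_derivative p x) (at x)"
    and "\<And>x. a \<le> x \<Longrightarrow> x \<le> b \<Longrightarrow> p x \<le> f x"
  shows "F b - F a \<le> integral {a..b} f"
proof -
  have "(p has_integral (F b - F a)) {a..b}"
    by (rule fundamental_theorem_of_calculus[OF assms(1)])
       (use assms(3) in \<open>auto simp: has_real_derivative_iff_has_vector_derivative[symmetric]
          intro: has_field_derivative_at_within\<close>)
  then show ?thesis
    by (rule has_integral_le[OF _ integrable_integral[OF assms(2)]]) (use assms(4) in auto)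
qed

text \<open>The last hypothesis says that x^m exp (- c x^2) has passed its maximum at b. Writing a =
  b (1 + d) reduces the claim to 1 + d \<le> exp d.\<close>

lemma power_exp_minus_square_mono:
  fixes a b c :: real
  assumes "0 < b" "b \<le> a" "real m \<le> 2 * c * b\<^sup>2"
  shows "a ^ m * exp (- (c * a\<^sup>2)) \<le> b ^ m * exp (- (c * b\<^sup>2))"
proof -
  define d where "d = (a - b) / b"
  have d: "0 \<le> d" "a = b * (1 + d)" using assms by (auto simp: d_def field_simps)
  have c: "0 \<le> c * b\<^sup>2" using assms(3) of_nat_0_le_iff[of m, where 'a=real] by linarith
  have "(1 + d) ^ m \<le> exp d ^ m" using d by (intro power_mono exp_ge_add_one_self) auto
  also have "\<dots> = exp (real m * d)" by (simp add: exp_of_nat_mult)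
  also have "\<dots> \<le> exp (c * b\<^sup>2 * (2 * d + d\<^sup>2))"
  proof -
    have "real m * d \<le> 2 * c * b\<^sup>2 * d" using assms(3) d by (intro mult_right_mono) auto
    moreover have "0 \<le> c * b\<^sup>2 * d\<^sup>2" using c by simp
    ultimately show ?thesis by (simp add: algebra_simps)
  qed
  finally have "b ^ m * (1 + d) ^ m * exp (- (c * a\<^sup>2)) \<le> b ^ m * exp (c * b\<^sup>2 * (2 * d + d\<^sup>2)) * exp (- (c * a\<^sup>2))"
    using assms by (intro mult_right_mono mult_left_mono) auto
  also have "\<dots> = b ^ m * exp (- (c * b\<^sup>2))"
    unfolding mult.assoc mult_exp_exp by (simp add: d(2) power2_eq_square algebra_simps)
  finally show ?thesis by (simp add: d(2) power_mult_distrib)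
qed

lemma exp_minus_of_nat_le: "exp (- real k) \<le> (1000 / 2718) ^ k"
proof -
  have "exp (- real k) = (1 / exp 1) ^ k"
    by (simp add: exp_minus power_divide inverse_eq_divide flip: exp_of_nat_mult)
  also have "\<dots> \<le> (1000 / 2718) ^ k"
  proof (rule power_mono)
    have "2718 / 1000 \<le> exp (1 :: real)" using abs_le_D2[OF e_approx_32] by simp
    then show "1 / exp 1 \<le> (1000 / 2718 :: real)" by (simp add: field_simps)
  qed simp
  finally show ?thesis .
qed

lemma cubic_le:
  fixes x b :: real
  assumes "0 \<le> x" "x \<le> b" "0 \<le> 21 / 20 * b\<^sup>2 - 7 / 2"
  shows "21 / 20 * x ^ 3 - 7 / 2 * x \<le> b * (21 / 20 * b\<^sup>2 - 7 / 2)"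
proof -
  have "x * (21 / 20 * x\<^sup>2 - 7 / 2) \<le> x * (21 / 20 * b\<^sup>2 - 7 / 2)"
    using assms by (intro mult_left_mono diff_right_mono power_mono) auto
  also have "\<dots> \<le> b * (21 / 20 * b\<^sup>2 - 7 / 2)"
    using assms by (intro mult_right_mono) auto
  finally show ?thesis by (simp add: eval_nat_numeral algebra_simps)
qed

text \<open>The saddle point of \<open>exp (n y) * P (exp (- y))\<close> would be \<open>moment 1 y = n\<close>. The shift
  \<open>7 / (2 y)\<close> partly compensates the cubic term of the phase, which widens the range where the
  integrand is positive.\<close>

locale saddle_point =
  fixes y :: real and n :: nat
  assumes y_pos: "0 < y" and saddle: "moment 1 y = real n + 7 / 2 / y" and n_ge: "600 \<le> n"
begin

text \<open>\<open>a\<close> squared is the leading term of log P (exp (- y)). The width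
  \<open>h\<close> is chosen so that \<open>moment_2_le\<close> bounds the drop of the log modulus
  at t = x h by exactly x^2.\<close>

definition "a = pi / (2 * sqrt y)"
definition "h = y / a"
definition "g t = exp (log_modulus y t - log_modulus y 0) * cos (phase y t - real n * t) * (1 - cos t)"

section \<open>Size of the parameters at the saddle point\<close>

lemma y_le: "y \<le> 613 / 10000"
proof (rule ccontr)
  assume "\<not> y \<le> 613 / 10000"
  then have y: "613 / 10000 < y" by simp
  have "real n + 7 / 2 / y \<le> pi\<^sup>2 / (4 * y\<^sup>2)"
    using moment_1_le[OF y_pos] unfolding saddle .
  then have "(real n + 7 / 2 / y) * (4 * y\<^sup>2) \<le> pi\<^sup>2"
    using y_pos by (simp add: pos_le_divide_eq)
  also have "(real n + 7 / 2 / y) * (4 * y\<^sup>2) = 4 * real n * y\<^sup>2 + 14 * y"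
    using y_pos by (simp add: power2_eq_square field_simps)
  \<comment> \<open>613/10000 lies just above the positive root of 4 * 600 * y^2 + 14 * y =
    pi^2.\<close>
  also have "4 * 600 * (613 / 10000)\<^sup>2 + 14 * (613 / 10000) \<le> 4 * real n * y\<^sup>2 + 14 * y"
    using n_ge y by (intro add_mono mult_mono power_mono) auto
  finally show False using pi_squared_bounds by (simp add: power2_eq_square)
qed

lemma a_pos: "0 < a" using y_pos by (simp add: a_def)

lemma a_squared: "a\<^sup>2 = pi\<^sup>2 / (4 * y)"
  using y_pos by (simp add: a_def power_divide power_mult_distrib)

lemma a_ge: "317 / 50 \<le> a"
proof -
  have "(317 / 50)\<^sup>2 \<le> 98695 / 10000 / (4 * (613 / 10000 :: real))" by (simp add: power2_eq_square)
  also have "\<dots> \<le> a\<^sup>2"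
    unfolding a_squared using y_le y_pos pi_squared_bounds by (intro frac_le mult_left_mono) auto
  finally show ?thesis by (rule power2_le_imp_le) (use a_pos in simp)
qed

lemma h_pos: "0 < h" using y_pos a_pos by (simp add: h_def)

lemma y_eq: "a * h = y" using a_pos by (simp add: h_def)

section \<open>Modulus and phase on the scale t = x h\<close>

lemma log_modulus_ge:
  assumes "0 \<le> x"
  shows "- x\<^sup>2 \<le> log_modulus y (x * h) - log_modulus y 0"
proof -
  have "log_modulus y 0 - log_modulus y (x * h) \<le> moment 2 y * (x * h)\<^sup>2 / 2"
    by (rule log_modulus_diff_le[OF y_pos])
  also have "\<dots> \<le> pi\<^sup>2 / (2 * y ^ 3) * (x * h)\<^sup>2 / 2"
    by (intro divide_right_mono mult_right_mono moment_2_le y_pos) auto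
  also have "\<dots> = x\<^sup>2 * (pi\<^sup>2 / (4 * y)) / a\<^sup>2"
    using y_pos a_pos by (simp add: h_def power_mult_distrib power_divide) (simp add: eval_nat_numeral field_simps)
  also have "\<dots> = x\<^sup>2" using a_pos by (simp flip: a_squared)
  finally show ?thesis by simp
qed

lemma phase_upper:
  assumes "0 \<le> x"
  shows "phase y (x * h) - real n * (x * h) \<le> 7 / 2 * x / a"
proof -
  have "phase y (x * h) \<le> (real n + 7 / 2 / y) * (x * h)"
    unfolding saddle[symmetric] using assms h_pos by (intro phase_le y_pos) simp
  moreover have "7 / 2 / y * (x * h) = 7 / 2 * x / a"
    using y_pos by (simp add: h_def)
  ultimately show ?thesis by (simp add: distrib_right)
qed

text \<open>The constant 63/10 in place of 6 in the third power sum is what makes the cubic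
  coefficient 21/20 instead of 1.\<close>

lemma phase_lower:
  assumes "0 \<le> x"
  shows "(7 / 2 * x - 21 / 20 * x ^ 3) / a \<le> phase y (x * h) - real n * (x * h)"
proof -
  have "(real n + 7 / 2 / y) * (x * h) - moment 3 y * (x * h) ^ 3 / 6 \<le> phase y (x * h)"
    unfolding saddle[symmetric] using assms h_pos by (intro phase_ge y_pos) simp
  moreover have "moment 3 y * (x * h) ^ 3 / 6 \<le> 63 / 40 * pi\<^sup>2 / y ^ 4 * (x * h) ^ 3 / 6"
    using assms h_pos by (intro divide_right_mono mult_right_mono moment_3_le y_pos) auto
  moreover have "63 / 40 * pi\<^sup>2 / y ^ 4 * (x * h) ^ 3 / 6 = 21 / 20 * x ^ 3 * (pi\<^sup>2 / (4 * y)) / a ^ 3"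
    using y_pos a_pos by (simp add: h_def power_mult_distrib power_divide) (simp add: eval_nat_numeral field_simps)
  moreover have "21 / 20 * x ^ 3 * (pi\<^sup>2 / (4 * y)) / a ^ 3 = 21 / 20 * x ^ 3 / a"
    using a_pos unfolding a_squared[symmetric] by (simp add: eval_nat_numeral field_simps)
  moreover have "7 / 2 / y * (x * h) = 7 / 2 * x / a"
    using y_pos by (simp add: h_def)
  ultimately show ?thesis by (simp add: distrib_right diff_divide_distrib)
qed

text \<open>At x = 131/50 the numerators of the two phase bounds are 9.17 and about 9.71, both below
  pi / 2 * 317/50, which is about 9.96: the shift 7/2 nearly balances them. Without it the cubic
  term would reach this limit near x = 2.1.\<close>

lemma g_nonneg:
  assumes "0 \<le> x" "x \<le> 131 / 50"
  shows "0 \<le> g (x * h)"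
proof -
  have "phase y (x * h) - real n * (x * h) \<le> pi / 2"
  proof -
    have "7 / 2 * x / a \<le> 7 / 2 * (131 / 50) / (317 / 50)"
      using assms a_ge by (intro frac_le) auto
    then show ?thesis using phase_upper[OF assms(1)] pi_approx by simp
  qed
  moreover have "- (pi / 2) \<le> phase y (x * h) - real n * (x * h)"
  proof -
    have "(21 / 20 * x ^ 3 - 7 / 2 * x) / a \<le> (131 / 50 * (21 / 20 * (131 / 50)\<^sup>2 - 7 / 2)) / (317 / 50)"
      using assms a_ge cubic_le[of x "131 / 50"] by (intro frac_le) (auto simp: power2_eq_square)
    also have "\<dots> \<le> pi / 2" using pi_approx by (simp add: power2_eq_square)
    finally have "(21 / 20 * x ^ 3 - 7 / 2 * x) / a \<le> pi / 2" .
    moreover have "(7 / 2 * x - 21 / 20 * x ^ 3) / a = - ((21 / 20 * x ^ 3 - 7 / 2 * x) / a)"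
      by (simp add: minus_divide_left)
    ultimately show ?thesis using phase_lower[OF assms(1)] by linarith
  qed
  ultimately show ?thesis unfolding g_def by (intro mult_nonneg_nonneg cos_ge_zero) auto
qed

text \<open>Up to x = 6/5 the lower phase bound is nonnegative, so the phase lies between 0 and 7/2
  * x / a. The three constants bound its cosine, exp (- (6/5)^2) and (1 - cos t) / t^2.\<close>

lemma g_main:
  assumes "0 \<le> x" "x \<le> 6 / 5"
  shows "78 / 100 * (22 / 100) * (499 / 1000) * (x * h)\<^sup>2 \<le> g (x * h)"
proof -
  define s where "s = phase y (x * h) - real n * (x * h)"
  have "\<bar>s\<bar> \<le> 7 / 2 * x / a"
  proof -
    have "0 \<le> (7 / 2 * x - 21 / 20 * x ^ 3) / a"
    proof -
      have "x\<^sup>2 \<le> (6 / 5)\<^sup>2" using assms by (intro power_mono) auto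
      then have "0 \<le> x * (7 / 2 - 21 / 20 * x\<^sup>2)" using assms by (intro mult_nonneg_nonneg) (auto simp: power2_eq_square)
      then show ?thesis using a_pos by (simp add: eval_nat_numeral algebra_simps)
    qed
    then show ?thesis using phase_upper[OF assms(1)] phase_lower[OF assms(1)] by (simp add: s_def)
  qed
  also have "7 / 2 * x / a \<le> 7 / 2 * (6 / 5) / (317 / 50)"
    using assms a_ge by (intro frac_le) auto
  finally have "\<bar>s\<bar>\<^sup>2 \<le> (7 / 2 * (6 / 5) / (317 / 50))\<^sup>2" by (intro power_mono) auto
  then have cos: "78 / 100 \<le> cos s" using one_minus_cos_le[of s] by (simp add: power2_eq_square)
  have "(1 - 36 / 25 / real 16) ^ 16 \<le> exp (- (36 / 25 :: real))"
    by (rule exp_ge_one_minus_x_over_n_power_n) auto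
  then have "22 / 100 \<le> exp (- (36 / 25 :: real))" by (simp add: power_divide)
  also have "\<dots> \<le> exp (log_modulus y (x * h) - log_modulus y 0)"
  proof -
    have "x\<^sup>2 \<le> (6 / 5)\<^sup>2" using assms by (intro power_mono) auto
    then show ?thesis using log_modulus_ge[OF assms(1)] by (simp add: power2_eq_square)
  qed
  finally have E: "22 / 100 * (78 / 100) \<le> exp (log_modulus y (x * h) - log_modulus y 0) * cos s"
    using cos by (intro mult_mono) auto
  have C: "499 / 1000 * (x * h)\<^sup>2 \<le> 1 - cos (x * h)"
  proof (rule one_minus_cos_ge)
    have "x * h \<le> 6 / 5 * h" using assms h_pos by (intro mult_right_mono) auto
    also have "h \<le> 613 / 10000 / (317 / 50)"
      unfolding h_def using y_le a_ge y_pos by (intro frac_le) auto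
    finally show "x * h \<le> 1 / 8" by simp
  qed (use assms h_pos in simp)
  have "22 / 100 * (78 / 100) * (499 / 1000 * (x * h)\<^sup>2) \<le> exp (log_modulus y (x * h) - log_modulus y 0) * cos s * (1 - cos (x * h))"
  proof (rule mult_mono[OF E C])
    show "0 \<le> exp (log_modulus y (x * h) - log_modulus y 0) * cos s" using E by linarith
  qed simp
  then show ?thesis by (simp add: g_def s_def)
qed

text \<open>Away from the peak the phase is uncontrolled, so its cosine is only bounded by - 1 and
  the decay of the modulus has to do the work.\<close>

lemma g_ge:
  assumes "0 \<le> s" "s \<le> 2 * y" "s \<le> t" "t \<le> pi" "c \<le> 4 / 5 * (s\<^sup>2 / (y\<^sup>2 + s\<^sup>2))"
  shows "- (exp (- (c * a\<^sup>2)) * (1 - cos t)) \<le> g t"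
proof -
  have "c * a\<^sup>2 \<le> 4 / 5 * (s\<^sup>2 / (y\<^sup>2 + s\<^sup>2)) * a\<^sup>2" using assms(5) by (intro mult_right_mono) auto
  also have "\<dots> = 4 / 5 * (pi\<^sup>2 / (4 * y)) * (s\<^sup>2 / (y\<^sup>2 + s\<^sup>2))"
    by (simp only: a_squared ac_simps)
  also have "\<dots> \<le> log_modulus y 0 - log_modulus y t"
    using assms y_pos y_le by (intro log_modulus_diff_ge) auto
  finally have "exp (log_modulus y t - log_modulus y 0) \<le> exp (- (c * a\<^sup>2))" by simp
  moreover have "exp (log_modulus y t - log_modulus y 0) * (- cos (phase y t - real n * t)) \<le>
      exp (log_modulus y t - log_modulus y 0) * 1"
    by (rule mult_left_mono[OF _ exp_ge_zero])
       (use cos_ge_minus_one[of "phase y t - real n * t"] in linarith)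
  ultimately have "exp (log_modulus y t - log_modulus y 0) * (- cos (phase y t - real n * t)) \<le> exp (- (c * a\<^sup>2))"
    by linarith
  then have "exp (log_modulus y t - log_modulus y 0) * (- cos (phase y t - real n * t)) * (1 - cos t) \<le> exp (- (c * a\<^sup>2)) * (1 - cos t)"
    by (intro mult_right_mono) auto
  then show ?thesis by (simp add: g_def)
qed

section \<open>Lower bounds for the pieces of the integral\<close>

lemma g_integrable: "g integrable_on {0..pi}"
  and integral_eq: "integral {0..pi} (\<lambda>t. exp (log_modulus y t) * cos (phase y t - real n * t) * (1 - cos t)) =
     exp (log_modulus y 0) * integral {0..pi} g"
proof -
  let ?f = "\<lambda>t. exp (log_modulus y t) * cos (phase y t - real n * t) * (1 - cos t)"
  have f: "?f integrable_on {0..pi}"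
    using has_integral_second_difference[OF y_pos, of n] n_ge by (auto simp: integrable_on_def)
  have g: "g = (\<lambda>t. exp (- log_modulus y 0) * ?f t)"
    by (rule ext) (simp add: g_def exp_diff exp_minus field_simps)
  show "g integrable_on {0..pi}" unfolding g using f by (rule integrable_on_mult_right)
  have "integral {0..pi} g = exp (- log_modulus y 0) * integral {0..pi} ?f"
    unfolding g by (rule integral_mult_right)
  then show "integral {0..pi} ?f = exp (log_modulus y 0) * integral {0..pi} g"
    by (simp add: exp_minus)
qed

lemma g_integrable_on: "0 \<le> u \<Longrightarrow> v \<le> pi \<Longrightarrow> g integrable_on {u..v}"
  by (rule integrable_on_subinterval[OF g_integrable]) auto

lemma integral_main: "49 / 1000 * h ^ 3 \<le> integral {0..6 / 5 * h} g"
proof -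
  let ?C = "78 / 100 * (22 / 100) * (499 / 1000) :: real"
  have "6 / 5 * h \<le> pi"
  proof -
    have "h \<le> y / 1" unfolding h_def using a_ge y_pos by (intro divide_left_mono) auto
    then show ?thesis using y_le pi_ge_two by linarith
  qed
  then have "?C * (6 / 5 * h) ^ 3 / 3 - ?C * 0 ^ 3 / 3 \<le> integral {0..6 / 5 * h} g"
  proof (intro integral_ge_of_antiderivative[where p = "\<lambda>t. ?C * t\<^sup>2"] g_integrable_on)
    fix t assume t: "0 \<le> t" "t \<le> 6 / 5 * h"
    show "((\<lambda>t. ?C * t ^ 3 / 3) has_real_derivative ?C * t\<^sup>2) (at t)"
      by (auto intro!: derivative_eq_intros)
    show "?C * t\<^sup>2 \<le> g t"
      using g_main[of "t / h"] t h_pos by (simp add: field_simps)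
  qed (use h_pos in auto)
  then have "?C * (6 / 5 * h) ^ 3 / 3 \<le> integral {0..6 / 5 * h} g" by simp
  moreover have "?C * (6 / 5 * h) ^ 3 / 3 = ?C * (216 / 125) / 3 * h ^ 3"
    by (simp add: power_mult_distrib power_divide)
  moreover have "0 \<le> h ^ 3" using h_pos by simp
  ultimately show ?thesis by linarith
qed

lemma integral_middle: "0 \<le> integral {6 / 5 * h..131 / 50 * h} g"
proof -
  have "131 / 50 * h \<le> pi"
  proof -
    have "h \<le> y / 1" unfolding h_def using a_ge y_pos by (intro divide_left_mono) auto
    then show ?thesis using y_le pi_ge_two by linarith
  qed
  then have "0 - 0 \<le> integral {6 / 5 * h..131 / 50 * h} g"
  proof (intro integral_ge_of_antiderivative[where p = "\<lambda>_. 0" and F = "\<lambda>_. 0"] g_integrable_on)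
    fix t assume t: "6 / 5 * h \<le> t" "t \<le> 131 / 50 * h"
    moreover have "0 \<le> 6 / 5 * h" using h_pos by simp
    ultimately have "0 \<le> t" by linarith
    then show "0 \<le> g t"
      using g_nonneg[of "t / h"] t h_pos by (simp add: field_simps)
  qed (use h_pos in auto)
  then show ?thesis by simp
qed

text \<open>In the proof, \<open>F t\<close> is half of \<open>exp (- (b * t\<^sup>2))\<close> times the usual bound
  \<open>t / (2 b) + 1 / (4 b\<^sup>2 t)\<close>
  for the tail of a Gaussian second moment.\<close>

lemma integral_gaussian_tail: "- (24 / 1000 * h ^ 3) \<le> integral {131 / 50 * h..3 / 5 * y} g"
proof -
  \<comment> \<open>For t \<le> 3/5 * y one has y^2 + t^2 \<le> 34/25 * y^2, and 4/5 divided by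
    34/25 is just above 147/250. Since a^2 / y^2 = 1 / h^2, the exponent becomes
    \<open>b * t\<^sup>2\<close>.\<close>
  define b where "b = 147 / 250 / h\<^sup>2"
  have b: "b > 0" using h_pos by (simp add: b_def)
  define F where "F t = (t / (2 * b) + 1 / (4 * b\<^sup>2 * t)) * exp (- (b * t\<^sup>2)) / 2" for t
  have "131 / 50 * h \<le> 3 / 5 * y"
    using a_ge h_pos mult_right_mono[of "131 / 50" "3 / 5 * a" h] by (simp add: mult.assoc y_eq)
  moreover have "3 / 5 * y \<le> pi" using y_le pi_ge_two by linarith
  ultimately have "F (3 / 5 * y) - F (131 / 50 * h) \<le> integral {131 / 50 * h..3 / 5 * y} g"
  proof (intro integral_ge_of_antiderivative[where p = "\<lambda>t. - ((t\<^sup>2 + 1 / (4 * b\<^sup>2 * t\<^sup>2)) * exp (- (b * t\<^sup>2)) / 2)"] g_integrable_on)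
    fix t assume t: "131 / 50 * h \<le> t" "t \<le> 3 / 5 * y"
    moreover have "0 < 131 / 50 * h" using h_pos by simp
    ultimately have t0: "0 < t" by linarith
    have "(F has_real_derivative ((1 / (2 * b) - 4 * b\<^sup>2 / (4 * b\<^sup>2 * t)\<^sup>2) * exp (- (b * t\<^sup>2)) +
        (t / (2 * b) + 1 / (4 * b\<^sup>2 * t)) * (exp (- (b * t\<^sup>2)) * (- (b * (2 * t))))) / 2) (at t)"
      unfolding F_def using b t0 by (auto intro!: derivative_eq_intros simp: power2_eq_square)
    moreover have "((1 / (2 * b) - 4 * b\<^sup>2 / (4 * b\<^sup>2 * t)\<^sup>2) * e + (t / (2 * b) + 1 / (4 * b\<^sup>2 * t)) * (e * (- (b * (2 * t))))) / 2
        = - ((t\<^sup>2 + 1 / (4 * b\<^sup>2 * t\<^sup>2)) * e / 2)" for e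
      using b t0 by (simp add: field_simps power2_eq_square)
    ultimately show "(F has_real_derivative - ((t\<^sup>2 + 1 / (4 * b\<^sup>2 * t\<^sup>2)) * exp (- (b * t\<^sup>2)) / 2)) (at t)"
      by simp
    have "- (exp (- (t\<^sup>2 * (147 / 250) / y\<^sup>2 * a\<^sup>2)) * (1 - cos t)) \<le> g t"
    proof (rule g_ge[of t])
      have "t\<^sup>2 \<le> (3 / 5 * y)\<^sup>2" using t t0 by (intro power_mono) auto
      then have "y\<^sup>2 + t\<^sup>2 \<le> 34 / 25 * y\<^sup>2" by (simp add: power2_eq_square)
      then have "t\<^sup>2 / (34 / 25 * y\<^sup>2) \<le> t\<^sup>2 / (y\<^sup>2 + t\<^sup>2)"
        using y_pos t0 by (intro divide_left_mono) (auto intro!: mult_pos_pos add_pos_pos)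
      moreover have "t\<^sup>2 * (147 / 250) / y\<^sup>2 \<le> 4 / 5 * (t\<^sup>2 / (34 / 25 * y\<^sup>2))"
        using y_pos by (simp add: field_simps)
      ultimately show "t\<^sup>2 * (147 / 250) / y\<^sup>2 \<le> 4 / 5 * (t\<^sup>2 / (y\<^sup>2 + t\<^sup>2))" by linarith
    qed (use t t0 y_le y_pos pi_approx in auto)
    also have "t\<^sup>2 * (147 / 250) / y\<^sup>2 * a\<^sup>2 = b * t\<^sup>2"
      using y_pos a_pos by (simp add: b_def h_def power_divide)
    finally have "- (exp (- (b * t\<^sup>2)) * (1 - cos t)) \<le> g t" .
    moreover have "exp (- (b * t\<^sup>2)) * (1 - cos t) \<le> exp (- (b * t\<^sup>2)) * (t\<^sup>2 / 2)"
      by (intro mult_left_mono one_minus_cos_le) auto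
    moreover have "exp (- (b * t\<^sup>2)) * (t\<^sup>2 / 2) \<le> (t\<^sup>2 + 1 / (4 * b\<^sup>2 * t\<^sup>2)) * exp (- (b * t\<^sup>2)) / 2"
    proof -
      have "t\<^sup>2 * exp (- (b * t\<^sup>2)) \<le> (t\<^sup>2 + 1 / (4 * b\<^sup>2 * t\<^sup>2)) * exp (- (b * t\<^sup>2))"
        by (intro mult_right_mono) auto
      then show ?thesis by (simp add: ac_simps)
    qed
    ultimately show "- ((t\<^sup>2 + 1 / (4 * b\<^sup>2 * t\<^sup>2)) * exp (- (b * t\<^sup>2)) / 2) \<le> g t" by linarith
  qed (use h_pos in auto)
  moreover have "0 \<le> F (3 / 5 * y)" using b y_pos by (simp add: F_def)
  moreover have "F (131 / 50 * h) \<le> 24 / 1000 * h ^ 3"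
  proof -
    have "b * (131 / 50 * h)\<^sup>2 = 147 / 250 * (131 / 50)\<^sup>2"
      using h_pos by (simp add: b_def power_mult_distrib power_divide)
    \<comment> \<open>147/250 * (131/50)^2 is just above 4.\<close>
    then have "exp (- (b * (131 / 50 * h)\<^sup>2)) \<le> exp (- real 4)" by (simp add: power2_eq_square)
    also have "\<dots> \<le> (1000 / 2718) ^ 4" by (rule exp_minus_of_nat_le)
    also have "\<dots> \<le> 1 / 54" by (simp add: power_divide)
    finally have e: "exp (- (b * (131 / 50 * h)\<^sup>2)) \<le> 1 / 54" .
    have "131 / 50 * h / (2 * b) + 1 / (4 * b\<^sup>2 * (131 / 50 * h)) =
        (131 / 50 / (2 * (147 / 250)) + 1 / (4 * (147 / 250)\<^sup>2 * (131 / 50))) * h ^ 3"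
      using h_pos by (simp add: b_def field_simps eval_nat_numeral)
    also have "\<dots> \<le> 251 / 100 * h ^ 3"
      using h_pos by (intro mult_right_mono) (auto simp: power2_eq_square)
    finally have "(131 / 50 * h / (2 * b) + 1 / (4 * b\<^sup>2 * (131 / 50 * h))) * exp (- (b * (131 / 50 * h)\<^sup>2))
        \<le> 251 / 100 * h ^ 3 * (1 / 54)"
      using e h_pos by (intro mult_mono) auto
    moreover have "0 \<le> h ^ 3" using h_pos by simp
    moreover have "z / 2 \<le> 24 / 1000 * k" if "z \<le> 251 / 100 * k * (1 / 54)" "0 \<le> k" for z k :: real
      using that by linarith
    ultimately show ?thesis unfolding F_def by blast
  qed
  ultimately show ?thesis by linarith
qed

text \<open>The decay is frozen at its value for t = u. The first bound, from 1 - cos t \<le> t^2 /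
  2, suits intervals of length comparable to y; the second, from 1 - cos t \<le> 2, suits the
  remainder up to pi.\<close>

lemma integral_far:
  assumes "0 \<le> u" "u \<le> v" "v \<le> pi" "u \<le> 2 * y" "c \<le> 4 / 5 * (u\<^sup>2 / (y\<^sup>2 + u\<^sup>2))"
  shows "- (exp (- (c * a\<^sup>2)) * (v ^ 3 - u ^ 3) / 6) \<le> integral {u..v} g"
    and "- (exp (- (c * a\<^sup>2)) * (2 * (v - u))) \<le> integral {u..v} g"
proof -
  let ?E = "exp (- (c * a\<^sup>2))"
  have g: "- (?E * (1 - cos t)) \<le> g t" if "u \<le> t" "t \<le> v" for t
    by (rule g_ge) (use that assms in auto)
  have "- (?E * v ^ 3 / 6) - - (?E * u ^ 3 / 6) \<le> integral {u..v} g"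
  proof (intro integral_ge_of_antiderivative[where p = "\<lambda>t. - (?E * (t\<^sup>2 / 2))"] g_integrable_on)
    fix t assume t: "u \<le> t" "t \<le> v"
    show "((\<lambda>t. - (?E * t ^ 3 / 6)) has_real_derivative - (?E * (t\<^sup>2 / 2))) (at t)"
      by (auto intro!: derivative_eq_intros)
    have "?E * (1 - cos t) \<le> ?E * (t\<^sup>2 / 2)" by (intro mult_left_mono one_minus_cos_le) auto
    then show "- (?E * (t\<^sup>2 / 2)) \<le> g t" using g[OF t] by linarith
  qed (use assms in auto)
  then show "- (?E * (v ^ 3 - u ^ 3) / 6) \<le> integral {u..v} g" by (simp add: field_simps)
  have "- (?E * 2 * v) - - (?E * 2 * u) \<le> integral {u..v} g"
  proof (intro integral_ge_of_antiderivative[where p = "\<lambda>t. - (?E * 2)"] g_integrable_on)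
    fix t assume t: "u \<le> t" "t \<le> v"
    show "((\<lambda>t. - (?E * 2 * t)) has_real_derivative - (?E * 2)) (at t)"
      by (auto intro!: derivative_eq_intros)
    have "?E * (1 - cos t) \<le> ?E * 2" using cos_ge_minus_one[of t] by (intro mult_left_mono) auto
    then show "- (?E * 2) \<le> g t" using g[OF t] by linarith
  qed (use assms in auto)
  then show "- (?E * (2 * (v - u))) \<le> integral {u..v} g" by (simp add: algebra_simps)
qed

text \<open>Each product decreases in \<open>a\<close> from 317/50 on, so its value there decides.
  The exponents 8, 16 and 25 are the integer parts of c * (317/50)^2.\<close>

lemma exp_a_bounds:
  "a ^ 3 * exp (- (21 / 100 * a\<^sup>2)) \<le> 9 / 100"
  "a ^ 3 * exp (- (2 / 5 * a\<^sup>2)) \<le> 1 / 1000"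
  "a ^ 9 * exp (- (16 / 25 * a\<^sup>2)) \<le> 1 / 1000"
proof -
  have *: "a ^ m * exp (- (c * a\<^sup>2)) \<le> (317 / 50) ^ m * (1000 / 2718) ^ k"
    if "real m \<le> 2 * c * (317 / 50)\<^sup>2" "real k \<le> c * (317 / 50)\<^sup>2" for m k c
  proof -
    have "a ^ m * exp (- (c * a\<^sup>2)) \<le> (317 / 50) ^ m * exp (- (c * (317 / 50)\<^sup>2))"
      using that(1) a_ge by (intro power_exp_minus_square_mono) auto
    also have "\<dots> \<le> (317 / 50) ^ m * exp (- real k)" using that(2) by (intro mult_left_mono) auto
    also have "\<dots> \<le> (317 / 50) ^ m * (1000 / 2718) ^ k" by (intro mult_left_mono exp_minus_of_nat_le) auto
    finally show ?thesis .
  qed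
  show "a ^ 3 * exp (- (21 / 100 * a\<^sup>2)) \<le> 9 / 100"
    by (rule order_trans[OF *[of 3 "21 / 100" 8]]) (simp_all add: power_divide)
  show "a ^ 3 * exp (- (2 / 5 * a\<^sup>2)) \<le> 1 / 1000"
    by (rule order_trans[OF *[of 3 "2 / 5" 16]]) (simp_all add: power_divide)
  show "a ^ 9 * exp (- (16 / 25 * a\<^sup>2)) \<le> 1 / 1000"
    by (rule order_trans[OF *[of 9 "16 / 25" 25]]) (simp_all add: power_divide)
qed

text \<open>In units of h^3 the peak contributes at least 0.049, while everything beyond x = 131/50
  costs at most 0.024 + 0.012 + 0.002 + 0.001 = 0.039.\<close>

lemma integral_nonneg: "0 \<le> integral {0..pi} g"
proof -
  have h3: "0 \<le> h ^ 3" using h_pos by simp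
  have y3: "y ^ 3 = a ^ 3 * h ^ 3" by (simp flip: power_mult_distrib add: y_eq)
  have yp: "2 * y \<le> pi" using y_le pi_ge_two by linarith
  \<comment> \<open>The rates 21/100, 2/5 and 16/25 are 4/5 * u^2 / (y^2 + u^2) at u = 3/5 * y, y
    and 2 * y, the first one rounded down.\<close>
  have I4: "- (12 / 1000 * h ^ 3) \<le> integral {3 / 5 * y..y} g"
  proof -
    have "- (exp (- (21 / 100 * a\<^sup>2)) * (y ^ 3 - (3 / 5 * y) ^ 3) / 6) \<le> integral {3 / 5 * y..y} g"
      by (rule integral_far(1)) (use y_pos yp in \<open>auto simp: power_mult_distrib field_simps\<close>)
    moreover have "exp (- (21 / 100 * a\<^sup>2)) * (y ^ 3 - (3 / 5 * y) ^ 3) / 6 = 49 / 375 * (a ^ 3 * exp (- (21 / 100 * a\<^sup>2))) * h ^ 3"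
      by (simp add: power_mult_distrib y3 power_divide)
    moreover have "49 / 375 * (a ^ 3 * exp (- (21 / 100 * a\<^sup>2))) * h ^ 3 \<le> 49 / 375 * (9 / 100) * h ^ 3"
      using h3 by (intro mult_right_mono mult_left_mono exp_a_bounds) auto
    ultimately show ?thesis using h3 by linarith
  qed
  have I5: "- (2 / 1000 * h ^ 3) \<le> integral {y..2 * y} g"
  proof -
    have "- (exp (- (2 / 5 * a\<^sup>2)) * ((2 * y) ^ 3 - y ^ 3) / 6) \<le> integral {y..2 * y} g"
      by (rule integral_far(1)) (use y_pos yp in \<open>auto simp: power_mult_distrib field_simps\<close>)
    moreover have "exp (- (2 / 5 * a\<^sup>2)) * ((2 * y) ^ 3 - y ^ 3) / 6 = 7 / 6 * (a ^ 3 * exp (- (2 / 5 * a\<^sup>2))) * h ^ 3"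
      by (simp add: power_mult_distrib y3)
    moreover have "7 / 6 * (a ^ 3 * exp (- (2 / 5 * a\<^sup>2))) * h ^ 3 \<le> 7 / 6 * (1 / 1000) * h ^ 3"
      using h3 by (intro mult_right_mono mult_left_mono exp_a_bounds) auto
    ultimately show ?thesis using h3 by linarith
  qed
  have I6: "- (1 / 1000 * h ^ 3) \<le> integral {2 * y..pi} g"
  proof -
    have "- (exp (- (16 / 25 * a\<^sup>2)) * (2 * (pi - 2 * y))) \<le> integral {2 * y..pi} g"
      by (rule integral_far(2)) (use y_pos yp in \<open>auto simp: power_mult_distrib field_simps\<close>)
    moreover have "exp (- (16 / 25 * a\<^sup>2)) * (2 * (pi - 2 * y)) \<le> 1 / 1000 * h ^ 3"
    proof -
      \<comment> \<open>The length of this interval does not shrink with y, so the loss is converted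
        by h^3 = pi^6 / (64 a^9). This is the origin of the ninth power in
        \<open>exp_a_bounds\<close>.\<close>
      have "4 * a ^ 3 * h = pi\<^sup>2"
        using a_squared y_pos a_pos by (simp add: h_def eval_nat_numeral field_simps)
      then have "(4 * a ^ 3 * h) ^ 3 = (pi\<^sup>2) ^ 3" by simp
      moreover have "9 ^ 3 \<le> (pi\<^sup>2) ^ 3" using pi_squared_bounds by (intro power_mono) auto
      ultimately have h9: "729 / 64 \<le> a ^ 9 * h ^ 3" by (simp add: power_mult_distrib flip: power_mult)
      have "exp (- (16 / 25 * a\<^sup>2)) * (2 * (pi - 2 * y)) \<le> exp (- (16 / 25 * a\<^sup>2)) * (729 / 64)"
        using pi_less_4 y_pos by (intro mult_left_mono) auto
      also have "\<dots> \<le> exp (- (16 / 25 * a\<^sup>2)) * (a ^ 9 * h ^ 3)"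
        by (intro mult_left_mono h9) auto
      also have "\<dots> = (a ^ 9 * exp (- (16 / 25 * a\<^sup>2))) * h ^ 3" by simp
      also have "\<dots> \<le> 1 / 1000 * h ^ 3"
        using h3 by (intro mult_right_mono exp_a_bounds) auto
      finally show ?thesis .
    qed
    ultimately show ?thesis by linarith
  qed
  have comb: "integral {u..v} g + integral {v..w} g = integral {u..w} g"
    if "0 \<le> u" "u \<le> v" "v \<le> w" "w \<le> pi" for u v w
    using that by (intro Henstock_Kurzweil_Integration.integral_combine g_integrable_on) auto
  have order: "131 / 50 * h \<le> 3 / 5 * y"
    using a_ge h_pos mult_right_mono[of "131 / 50" "3 / 5 * a" h] by (simp add: mult.assoc y_eq)
  have "integral {0..pi} g = integral {0..2 * y} g + integral {2 * y..pi} g"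
    using y_pos yp by (intro comb[symmetric]) auto
  also have "integral {0..2 * y} g = integral {0..y} g + integral {y..2 * y} g"
    using y_pos yp by (intro comb[symmetric]) auto
  also have "integral {0..y} g = integral {0..3 / 5 * y} g + integral {3 / 5 * y..y} g"
    using y_pos yp by (intro comb[symmetric]) auto
  also have "integral {0..3 / 5 * y} g = integral {0..131 / 50 * h} g + integral {131 / 50 * h..3 / 5 * y} g"
    using y_pos yp order h_pos by (intro comb[symmetric]) auto
  also have "integral {0..131 / 50 * h} g = integral {0..6 / 5 * h} g + integral {6 / 5 * h..131 / 50 * h} g"
    using y_pos yp order h_pos by (intro comb[symmetric]) auto
  finally show ?thesis
    using integral_main integral_middle integral_gaussian_tail I4 I5 I6 h3 by linarith
qed

end

lemma log_concave_large:
  assumes "600 \<le> n"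
  shows "num_overpartitions (n + 1) * num_overpartitions (n - 1) \<le> (num_overpartitions n)\<^sup>2"
proof -
  obtain y where y: "0 < y" "moment 1 y = real n + 7 / 2 / y"
    using exists_saddle_point[of n] assms by auto
  interpret saddle_point y n using y assms by unfold_locales
  show ?thesis
    using assms integral_nonneg by (intro log_concave_of_integral_nonneg[OF y(1)]) (auto simp: integral_eq)
qed

theorem theorem1p2:
  fixes n :: nat
  assumes "n \<ge> 2"
  shows "log_concave_at (\<lambda>m. real (num_overpartitions m)) n"
proof -
  let ?p = "\<lambda>m. real (num_overpartitions m)"
  have pos: "0 < ?p m" for m by (simp add: num_overpartitions_pos)
  have "num_overpartitions (n + 1) * num_overpartitions (n - 1) \<le> (num_overpartitions n)\<^sup>2"
    using assms log_concave_small[of n] log_concave_large[of n] by (cases "n \<le> 600") auto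
  then have "?p (n + 1) * ?p (n - 1) \<le> ?p n ^ 2"
    by (simp only: of_nat_le_iff flip: of_nat_mult of_nat_power)
  then have "ln (?p (n + 1) * ?p (n - 1)) \<le> ln (?p n ^ 2)"
    using pos by (intro ln_mono mult_pos_pos) auto
  then have "ln (?p (n + 1)) + ln (?p (n - 1)) \<le> 2 * ln (?p n)"
    using pos by (simp add: ln_mult ln_realpow)
  then show ?thesis
    using assms by (simp add: log_concave_at_def log_second_difference_def)
qed

end
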